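(* Let $\mathbb F$ be an algebraically closed field and let $q\in\mathbb F$ be nonzero and not a root of unity. Let $V$ denote an evaluation module for $\boxtimes_q$. Then the following $\boxtimes_q$-modules are isomorphic: (i) $V$; (ii) $V$ twisted via $\rho^2$.
   Context: Algebras are associative with 1. $[n]_q=(q^n-q^{-n})/(q-q^{-1})$ and $\mathbb Z_4=\mathbb Z/4\mathbb Z$. The $q$-tetrahedron algebra $\boxtimes_q$ is the $\mathbb F$-algebra with generators (called the standard generators) $\{x_{ij}\mid i,j\in\mathbb Z_4,\ j-i=1\text{ or }j-i=2\}$ and relations: (i) $x_{ij}x_{ji}=1$ if $j-i=2$; (ii) $\frac{qx_{ij}x_{jk}-q^{-1}x_{jk}x_{ij}}{q-q^{-1}}=1$ if $(j-i,k-j)$ is one of $(1,1),(1,2),(2,1)$; (iii) $x_{ij}^3x_{k\ell}-[3]_qx_{ij}^2x_{k\ell}x_{ij}+[3]_qx_{ij}x_{k\ell}x_{ij}^2-x_{k\ell}x_{ij}^3=0$ if $j-i=k-j=\ell-k=1$. $\rho$ is the automorphism of $\boxtimes_q$ sending each standard generator $x_{ij}$ to $x_{i+1,j+1}$. For a $\boxtimes_q$-module $V$ and an automorphism $\pi$ of $\boxtimes_q$, $V$ twisted via $\pi$ is the $\boxtimes_q$-module on the vector space $V$ in which $\zeta\in\boxtimes_q$ acts as $\pi^{-1}(\zeta)$ acts on the original module $V$. Known fact: on a finite-dimensional irreducible $\boxtimes_q$-module $V$ there are $d\in\mathbb N$ (the diameter) and $\varepsilon\in\{1,-1\}$ (the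 type) such that each standard generator is diagonalizable with set of distinct eigenvalues $\{\varepsilon q^{d-2n}\mid 0\le n\le d\}$. If $V$ has type 1, the sequence of dimensions of the eigenspaces of $x_{ij}$ for eigenvalues $q^{d},q^{d-2},\dots,q^{-d}$ does not depend on $x_{ij}$; it is called the shape of $V$. The trivial $\boxtimes_q$-module is the one-dimensional module on which every standard generator acts as the identity. An evaluation module for $\boxtimes_q$ is a nontrivial finite-dimensional irreducible $\boxtimes_q$-module of type 1 and shape $(1,1,\dots,1)$ (so $d\ge1$ and $\dim V=d+1$). *)

theory Defs
  imports
    "HOL-Algebra.QuotRing"
    "HOL-Algebra.Algebraic_Closure_Type"
    "HOL-Library.Poly_Mapping"
    "HOL-Library.Numeral_Type"
begin

section \<open>Free associative algebras\<close>

text \<open>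
  Words form the free monoid under concatenation.  It is written additively because the
  convolution product of \<^theory>\<open>HOL-Library.Poly_Mapping\<close> expects a (not necessarily
  commutative) \<^class>\<open>monoid_add\<close>; finitely supported functions from words to a field are then
  the free associative unital algebra.
\<close>

datatype 'a free_word = Free_Word (letters: "'a list")

instantiation free_word :: (type) monoid_add
begin

definition zero_free_word :: "'a free_word" where
  "0 = Free_Word []"

definition plus_free_word :: "'a free_word \<Rightarrow> 'a free_word \<Rightarrow> 'a free_word" where
  "u + v = Free_Word (letters u @ letters v)"

instance
  by standard (simp_all add: zero_free_word_def plus_free_word_def)

end

type_synonym ('a, 'f) free_algebra = "'a free_word \<Rightarrow>\<^sub>0 'f"

definition free_const :: "'f::field \<Rightarrow> ('a, 'f) free_algebra" where
  "free_const c = Poly_Mapping.single 0 c"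

definition free_var :: "'a \<Rightarrow> ('a, 'f::field) free_algebra" where
  "free_var g = Poly_Mapping.single (Free_Word [g]) 1"

definition relabel :: "('a \<Rightarrow> 'b) \<Rightarrow> ('a, 'f::field) free_algebra \<Rightarrow> ('b, 'f) free_algebra" where
  "relabel \<phi> p =
     (\<Sum>w\<in>Poly_Mapping.keys p.
        Poly_Mapping.single (map_free_word \<phi> w) (Poly_Mapping.lookup p w))"


section \<open>The \<open>q\<close>-tetrahedron algebra\<close>

text \<open>The type \<^typ>\<open>4\<close> is the ring of integers modulo 4.\<close>

typedef std_gen = "{(i :: 4, j :: 4). j - i = 1 \<or> j - i = 2}"
  by (rule exI[of _ "(0, 1)"]) simp

text \<open>\<open>std i j\<close> is meaningful only if \<open>j - i\<close> is 1 or 2; all uses below are guarded accordingly.\<close>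

definition std :: "4 \<Rightarrow> 4 \<Rightarrow> std_gen" where
  "std i j = Abs_std_gen (i, j)"

definition shift_gen :: "std_gen \<Rightarrow> std_gen" where
  "shift_gen g = (case Rep_std_gen g of (i, j) \<Rightarrow> std (i + 1) (j + 1))"

abbreviation free_std :: "4 \<Rightarrow> 4 \<Rightarrow> (std_gen, 'f::field) free_algebra" where
  "free_std i j \<equiv> free_var (std i j)"

definition qnum :: "'f::field \<Rightarrow> nat \<Rightarrow> 'f" where
  "qnum q n = (q ^ n - inverse q ^ n) / (q - inverse q)"

definition boxq_relators :: "'f::field \<Rightarrow> (std_gen, 'f) free_algebra set" where
  "boxq_relators q =
     {free_std i j * free_std j i - 1 | i j. j - i = 2} \<union>
     {free_const (inverse (q - inverse q)) *
        (free_const q * free_std i j * free_std j k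
          - free_const (inverse q) * free_std j k * free_std i j) - 1 | i j k.
        (j - i, k - j) \<in> {(1, 1), (1, 2), (2, 1)}} \<union>
     {free_std i j ^ 3 * free_std k l
        - free_const (qnum q 3) * free_std i j ^ 2 * free_std k l * free_std i j
        + free_const (qnum q 3) * free_std i j * free_std k l * free_std i j ^ 2
        - free_std k l * free_std i j ^ 3 | i j k l.
        j - i = 1 \<and> k - j = 1 \<and> l - k = 1}"

definition boxq_ideal :: "'f::field \<Rightarrow> (std_gen, 'f) free_algebra set" where
  "boxq_ideal q = Idl\<^bsub>ring_of_type_algebra\<^esub> (boxq_relators q)"

type_synonym 'f boxq_elem = "(std_gen, 'f) free_algebra set"

definition boxq :: "'f::field \<Rightarrow> 'f boxq_elem ring" where
  "boxq q = ring_of_type_algebra Quot boxq_ideal q"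

definition boxq_class :: "'f::field \<Rightarrow> (std_gen, 'f) free_algebra \<Rightarrow> 'f boxq_elem" where
  "boxq_class q p = boxq_ideal q +>\<^bsub>ring_of_type_algebra\<^esub> p"

definition boxq_x :: "'f::field \<Rightarrow> 4 \<Rightarrow> 4 \<Rightarrow> 'f boxq_elem" where
  "boxq_x q i j = boxq_class q (free_std i j)"

definition boxq_smult :: "'f::field \<Rightarrow> 'f \<Rightarrow> 'f boxq_elem \<Rightarrow> 'f boxq_elem" where
  "boxq_smult q c \<zeta> = boxq_class q (free_const c) \<otimes>\<^bsub>boxq q\<^esub> \<zeta>"

definition boxq_automorphism :: "'f::field \<Rightarrow> ('f boxq_elem \<Rightarrow> 'f boxq_elem) \<Rightarrow> bool" where
  "boxq_automorphism q \<pi> \<longleftrightarrow>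
     \<pi> \<in> ring_iso (boxq q) (boxq q) \<and>
     (\<forall>c. \<forall>\<zeta>\<in>carrier (boxq q). \<pi> (boxq_smult q c \<zeta>) = boxq_smult q c (\<pi> \<zeta>))"

text \<open>
  The elements of \<open>boxq q\<close> are cosets, and \<open>\<rho>\<close> maps a coset to its image under the relabelling of
  the generators; see \<open>boxq_automorphism_rho\<close> and \<open>rho_boxq_x\<close> below.
\<close>

definition rho :: "'f::field boxq_elem \<Rightarrow> 'f boxq_elem" where
  "rho C = relabel shift_gen ` C"


section \<open>Modules\<close>

text \<open>
  The carrier of a module is a whole type \<open>'v\<close>; \<open>act \<zeta> v\<close> matters only for \<open>\<zeta>\<close> in the carrier of
  \<open>boxq q\<close>.
\<close>

locale boxq_module = vector_space scale
  for q :: "'f::field"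
  and scale :: "'f \<Rightarrow> 'v::ab_group_add \<Rightarrow> 'v" (infixr \<open>*s\<close> 75)
  and act :: "'f boxq_elem \<Rightarrow> 'v \<Rightarrow> 'v" +
  assumes act_linear: "\<zeta> \<in> carrier (boxq q) \<Longrightarrow> Vector_Spaces.linear scale scale (act \<zeta>)"
    and act_add: "\<lbrakk>\<zeta> \<in> carrier (boxq q); \<eta> \<in> carrier (boxq q)\<rbrakk>
           \<Longrightarrow> act (\<zeta> \<oplus>\<^bsub>boxq q\<^esub> \<eta>) v = act \<zeta> v + act \<eta> v"
    and act_mult: "\<lbrakk>\<zeta> \<in> carrier (boxq q); \<eta> \<in> carrier (boxq q)\<rbrakk>
           \<Longrightarrow> act (\<zeta> \<otimes>\<^bsub>boxq q\<^esub> \<eta>) v = act \<zeta> (act \<eta> v)"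
    and act_one: "act \<one>\<^bsub>boxq q\<^esub> v = v"
    and act_smult: "\<zeta> \<in> carrier (boxq q) \<Longrightarrow> act (boxq_smult q c \<zeta>) v = c *s act \<zeta> v"
begin

definition fin_dim :: bool where
  "fin_dim \<longleftrightarrow> (\<exists>B. finite B \<and> span B = UNIV)"

definition submodule :: "'v set \<Rightarrow> bool" where
  "submodule W \<longleftrightarrow> subspace W \<and> (\<forall>\<zeta>\<in>carrier (boxq q). \<forall>w\<in>W. act \<zeta> w \<in> W)"

definition irreducible_module :: bool where
  "irreducible_module \<longleftrightarrow>
     (UNIV :: 'v set) \<noteq> {0} \<and> (\<forall>W. submodule W \<longrightarrow> W = {0} \<or> W = UNIV)"

definition trivial_module :: bool where
  "trivial_module \<longleftrightarrow>
     dim (UNIV :: 'v set) = 1 \<and>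
     (\<forall>i j. j - i = 1 \<or> j - i = 2 \<longrightarrow> (\<forall>v. act (boxq_x q i j) v = v))"

definition eigenspace :: "('v \<Rightarrow> 'v) \<Rightarrow> 'f \<Rightarrow> 'v set" where
  "eigenspace T \<mu> = {v. T v = \<mu> *s v}"

definition eigenvalues :: "('v \<Rightarrow> 'v) \<Rightarrow> 'f set" where
  "eigenvalues T = {\<mu>. \<exists>v. v \<noteq> 0 \<and> T v = \<mu> *s v}"

definition diagonalizable :: "('v \<Rightarrow> 'v) \<Rightarrow> bool" where
  "diagonalizable T \<longleftrightarrow>
     (\<exists>B. independent B \<and> span B = UNIV \<and> (\<forall>b\<in>B. \<exists>\<mu>. T b = \<mu> *s b))"

definition diameter_and_type :: "nat \<Rightarrow> 'f \<Rightarrow> bool" where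
  "diameter_and_type d \<epsilon> \<longleftrightarrow>
     \<epsilon> \<in> {1, -1} \<and>
     (\<forall>i j. j - i = 1 \<or> j - i = 2 \<longrightarrow>
        diagonalizable (act (boxq_x q i j)) \<and>
        eigenvalues (act (boxq_x q i j)) = {\<epsilon> * q powi (int d - 2 * int n) | n. n \<le> d})"

text \<open>The shape of a module of type 1 and diameter \<open>d\<close>.\<close>

definition has_shape :: "nat \<Rightarrow> nat list \<Rightarrow> bool" where
  "has_shape d s \<longleftrightarrow>
     (\<forall>i j. j - i = 1 \<or> j - i = 2 \<longrightarrow>
        map (\<lambda>n. dim (eigenspace (act (boxq_x q i j)) (q powi (int d - 2 * int n)))) [0..<Suc d] = s)"

definition evaluation_module :: bool where
  "evaluation_module \<longleftrightarrow>
     fin_dim \<and> irreducible_module \<and> \<not> trivial_module \<and>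
     (\<exists>d. diameter_and_type d 1 \<and> has_shape d (replicate (Suc d) 1))"

end

definition twist :: "'f::field \<Rightarrow> ('f boxq_elem \<Rightarrow> 'f boxq_elem) \<Rightarrow>
    ('f boxq_elem \<Rightarrow> 'v \<Rightarrow> 'v) \<Rightarrow> 'f boxq_elem \<Rightarrow> 'v \<Rightarrow> 'v" where
  "twist q \<pi> act \<zeta> = act (inv_into (carrier (boxq q)) \<pi> \<zeta>)"

definition boxq_isomorphic ::
  "'f::field \<Rightarrow> ('f \<Rightarrow> 'v::ab_group_add \<Rightarrow> 'v) \<Rightarrow> ('f boxq_elem \<Rightarrow> 'v \<Rightarrow> 'v) \<Rightarrow>
   ('f \<Rightarrow> 'w::ab_group_add \<Rightarrow> 'w) \<Rightarrow> ('f boxq_elem \<Rightarrow> 'w \<Rightarrow> 'w) \<Rightarrow> bool" where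
  "boxq_isomorphic q scaleV actV scaleW actW \<longleftrightarrow>
     boxq_module q scaleV actV \<and> boxq_module q scaleW actW \<and>
     (\<exists>f. Vector_Spaces.linear scaleV scaleW f \<and> bij f \<and>
          (\<forall>\<zeta>\<in>carrier (boxq q). \<forall>v. f (actV \<zeta> v) = actW \<zeta> (f v)))"


section \<open>The map \<open>rho\<close> is an automorphism\<close>

lemma relabel_zero [simp]: "relabel \<phi> 0 = 0"
  by (simp add: relabel_def)

lemma relabel_add: "relabel \<phi> (p + r) = relabel \<phi> p + relabel \<phi> r"
  unfolding relabel_def
  by (rule Poly_Mapping.setsum_keys_plus_distrib) (simp_all add: Poly_Mapping.single_add)

lemma relabel_uminus: "relabel \<phi> (- p) = - relabel \<phi> p"
  by (metis add.right_inverse neg_eq_iff_add_eq_0 relabel_add relabel_zero)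

lemma relabel_diff: "relabel \<phi> (p - r) = relabel \<phi> p - relabel \<phi> r"
  by (metis add_uminus_conv_diff relabel_add relabel_uminus)

lemma relabel_single:
  "relabel \<phi> (Poly_Mapping.single w c) = Poly_Mapping.single (map_free_word \<phi> w) c"
  by (simp add: relabel_def)

lemma relabel_sum: "relabel \<phi> (\<Sum>x\<in>A. f x) = (\<Sum>x\<in>A. relabel \<phi> (f x))"
  by (induction A rule: infinite_finite_induct) (simp_all add: relabel_add)

lemma map_free_word_add: "map_free_word \<phi> (u + v) = map_free_word \<phi> u + map_free_word \<phi> v"
  by (cases u; cases v) (simp add: plus_free_word_def)

lemma map_free_word_zero [simp]: "map_free_word \<phi> 0 = 0"
  by (simp add: zero_free_word_def)

lemma free_algebra_expand:
  "p = (\<Sum>w\<in>Poly_Mapping.keys p. Poly_Mapping.single w (Poly_Mapping.lookup p w))"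
  by (rule poly_mapping_eqI)
     (simp add: lookup_sum lookup_single when_def sum.delta' in_keys_iff)

lemma relabel_mult: "relabel \<phi> (p * r) = relabel \<phi> p * relabel \<phi> r"
proof -
  have "p * r = (\<Sum>u\<in>Poly_Mapping.keys p. \<Sum>v\<in>Poly_Mapping.keys r.
      Poly_Mapping.single (u + v) (Poly_Mapping.lookup p u * Poly_Mapping.lookup r v))"
    by (subst free_algebra_expand[of p], subst free_algebra_expand[of r])
       (simp add: sum_product Poly_Mapping.mult_single)
  then have "relabel \<phi> (p * r) = (\<Sum>u\<in>Poly_Mapping.keys p. \<Sum>v\<in>Poly_Mapping.keys r.
      Poly_Mapping.single (map_free_word \<phi> u + map_free_word \<phi> v)
        (Poly_Mapping.lookup p u * Poly_Mapping.lookup r v))"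
    by (simp add: relabel_sum relabel_single map_free_word_add)
  also have "\<dots> = relabel \<phi> p * relabel \<phi> r"
    by (simp add: relabel_def sum_product Poly_Mapping.mult_single)
  finally show ?thesis .
qed

lemma relabel_const [simp]: "relabel \<phi> (free_const c) = free_const c"
  by (simp add: free_const_def relabel_single)

lemma relabel_one [simp]: "relabel \<phi> 1 = 1"
  using relabel_const[of \<phi> 1] by (simp add: free_const_def)

lemma relabel_power: "relabel \<phi> (p ^ n) = relabel \<phi> p ^ n"
  by (induction n) (simp_all add: relabel_mult)

lemma relabel_var [simp]: "relabel \<phi> (free_var g) = free_var (\<phi> g)"
  by (simp add: free_var_def relabel_single)

lemma relabel_relabel: "relabel \<phi> (relabel \<psi> p) = relabel (\<phi> \<circ> \<psi>) p"
  by (simp add: relabel_def[of \<psi>] relabel_def[of "\<phi> \<circ> \<psi>"] relabel_sum relabel_single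
      free_word.map_comp)

lemma relabel_id [simp]: "relabel (\<lambda>x. x) p = p"
  using free_algebra_expand[of p] by (simp add: relabel_def free_word.map_ident)

lemma shift_gen_std:
  assumes "j - i = 1 \<or> j - i = 2"
  shows "shift_gen (std i j) = std (i + 1) (j + 1)"
  using assms by (simp add: shift_gen_def std_def Abs_std_gen_inverse)

lemma std_gen_cases:
  obtains i j where "g = std i j" "j - i = 1 \<or> j - i = 2"
  by (cases g) (auto simp: std_def)

lemma shift_gen_4: "shift_gen (shift_gen (shift_gen (shift_gen g))) = g"
proof (cases g rule: std_gen_cases)
  case (1 i j)
  have *: "i + 1 + 1 + 1 + 1 = i" for i :: 4
  proof -
    have "(1 + 1 + 1 + 1 :: 4) = 0" by simp
    then show ?thesis by (metis add.assoc add.right_neutral)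
  qed
  from 1 have d: "(j + 1) - (i + 1) = 1 \<or> (j + 1) - (i + 1) = 2"
    "(j + 1 + 1) - (i + 1 + 1) = 1 \<or> (j + 1 + 1) - (i + 1 + 1) = 2"
    "(j + 1 + 1 + 1) - (i + 1 + 1 + 1) = 1 \<or> (j + 1 + 1 + 1) - (i + 1 + 1 + 1) = 2"
    by (simp_all only: add_diff_cancel_right)
  show ?thesis
    by (simp only: 1(1) shift_gen_std[OF 1(2)] shift_gen_std[OF d(1)] shift_gen_std[OF d(2)]
        shift_gen_std[OF d(3)] *)
qed

lemma relabel_shift_4:
  "relabel shift_gen (relabel shift_gen (relabel shift_gen (relabel shift_gen p))) = p"
proof -
  have "shift_gen \<circ> shift_gen \<circ> shift_gen \<circ> shift_gen = (\<lambda>x. x)"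
    by (simp add: fun_eq_iff shift_gen_4)
  then show ?thesis by (simp add: relabel_relabel comp_assoc)
qed

lemma ring_type_algebra: "ring (ring_of_type_algebra :: 'a::ring_1 ring)"
proof -
  have "\<exists>y. x + y = 0" for x :: 'a
    using add.right_inverse by blast
  then show ?thesis
    unfolding ring_of_type_algebra_def using add.right_inverse
    by unfold_locales (auto simp: algebra_simps Units_def)
qed

lemma type_algebra_simps [simp]:
  "carrier ring_of_type_algebra = UNIV"
  "a \<oplus>\<^bsub>ring_of_type_algebra\<^esub> b = a + b"
  "a \<otimes>\<^bsub>ring_of_type_algebra\<^esub> b = a * b"
  "\<one>\<^bsub>ring_of_type_algebra\<^esub> = 1"
  "\<zero>\<^bsub>ring_of_type_algebra\<^esub> = 0"
  by (simp_all add: ring_of_type_algebra_def)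

lemma ideal_boxq_ideal: "ideal (boxq_ideal q) ring_of_type_algebra"
  unfolding boxq_ideal_def by (rule ring.genideal_ideal[OF ring_type_algebra]) simp

lemma ring_boxq: "ring (boxq q)"
  unfolding boxq_def by (rule ideal.quotient_is_ring[OF ideal_boxq_ideal])

lemma boxq_relators_subset: "boxq_relators q \<subseteq> boxq_ideal q"
  unfolding boxq_ideal_def by (rule ring.genideal_self[OF ring_type_algebra]) simp

lemma carrier_boxq: "carrier (boxq q) = range (boxq_class q)"
  by (auto simp: boxq_def FactRing_def A_RCOSETS_def' boxq_class_def)

lemma boxq_class_hom: "boxq_class q \<in> ring_hom ring_of_type_algebra (boxq q)"
  using ideal.rcos_ring_hom[OF ideal_boxq_ideal[of q]]
  by (simp add: boxq_def boxq_class_def[abs_def])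

lemma boxq_class_add: "boxq_class q (p + r) = boxq_class q p \<oplus>\<^bsub>boxq q\<^esub> boxq_class q r"
  using ring_hom_add[OF boxq_class_hom, of p r] by simp

lemma boxq_class_mult: "boxq_class q (p * r) = boxq_class q p \<otimes>\<^bsub>boxq q\<^esub> boxq_class q r"
  using ring_hom_mult[OF boxq_class_hom, of p r] by simp

lemma boxq_class_one: "boxq_class q 1 = \<one>\<^bsub>boxq q\<^esub>"
  using ring_hom_one[OF boxq_class_hom] by simp

lemma boxq_class_eq: "boxq_class q p = {h + p | h. h \<in> boxq_ideal q}"
  by (auto simp: boxq_class_def a_r_coset_def r_coset_def)

lemma relabel_relators: "r \<in> boxq_relators q \<Longrightarrow> relabel shift_gen r \<in> boxq_relators q"
proof -
  assume "r \<in> boxq_relators q"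
  then consider
    (1) i j where "j - i = 2" "r = free_std i j * free_std j i - 1"
  | (2) i j k where "(j - i, k - j) \<in> {(1, 1), (1, 2), (2, 1)}"
      "r = free_const (inverse (q - inverse q)) *
        (free_const q * free_std i j * free_std j k
          - free_const (inverse q) * free_std j k * free_std i j) - 1"
  | (3) i j k l where "j - i = 1" "k - j = 1" "l - k = 1"
     "r = free_std i j ^ 3 * free_std k l
        - free_const (qnum q 3) * free_std i j ^ 2 * free_std k l * free_std i j
        + free_const (qnum q 3) * free_std i j * free_std k l * free_std i j ^ 2
        - free_std k l * free_std i j ^ 3"
    unfolding boxq_relators_def by blast
  then show ?thesis
  proof cases
    case 1
    then have "i - j = 2"
    proof -
      have "i - j = - 2" using 1(1) by (metis minus_diff_eq)
      also have "\<dots> = 2" by (rule minus_unique) simp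
      finally show ?thesis .
    qed
    with 1 show ?thesis
      unfolding boxq_relators_def
      by (intro UnI1 CollectI exI[of _ "i + 1"] exI[of _ "j + 1"])
         (simp add: relabel_diff relabel_mult shift_gen_std)
  next
    case 2
    then have "j - i = 1 \<or> j - i = 2" "k - j = 1 \<or> k - j = 2" by auto
    with 2 show ?thesis
      unfolding boxq_relators_def
      by (intro UnI1[OF UnI2] CollectI exI[of _ "i + 1"] exI[of _ "j + 1"] exI[of _ "k + 1"])
         (simp add: relabel_diff relabel_mult shift_gen_std)
  next
    case 3
    then show ?thesis
      unfolding boxq_relators_def
      by (intro UnI2 CollectI exI[of _ "i + 1"] exI[of _ "j + 1"] exI[of _ "k + 1"] exI[of _ "l + 1"])
         (simp add: relabel_diff relabel_add relabel_mult relabel_power shift_gen_std)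
  qed
qed

lemma relabel_ideal: "p \<in> boxq_ideal q \<Longrightarrow> relabel shift_gen p \<in> boxq_ideal q"
proof -
  let ?J = "{p. relabel shift_gen p \<in> boxq_ideal q}"
  interpret I: ideal "boxq_ideal q" ring_of_type_algebra by (rule ideal_boxq_ideal)
  have "ideal ?J ring_of_type_algebra"
  proof (rule idealI[OF ring_type_algebra])
    show "subgroup ?J (add_monoid ring_of_type_algebra)"
    proof (rule group.subgroupI[OF I.a_group])
      have "0 \<in> ?J"
        using additive_subgroup.zero_closed[OF I.additive_subgroup_axioms] by simp
      then show "?J \<noteq> {}" by blast
    next
      fix a assume "a \<in> ?J"
      moreover have "inv\<^bsub>add_monoid ring_of_type_algebra\<^esub> a = - a"
        using I.minus_equality[of "- a" a] by (simp add: a_inv_def)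
      ultimately show "inv\<^bsub>add_monoid ring_of_type_algebra\<^esub> a \<in> ?J"
        using I.I_l_closed[of "relabel shift_gen a" "- 1"] by (simp add: relabel_uminus)
    qed (use additive_subgroup.a_closed[OF I.additive_subgroup_axioms] in \<open>auto simp: relabel_add\<close>)
  qed (use I.I_l_closed I.I_r_closed in \<open>auto simp: relabel_mult\<close>)
  moreover have "boxq_relators q \<subseteq> ?J"
    using relabel_relators boxq_relators_subset by auto
  ultimately have "boxq_ideal q \<subseteq> ?J"
    using ring.genideal_minimal[OF ring_type_algebra, of ?J "boxq_relators q"]
    by (simp only: boxq_ideal_def)
  then show "p \<in> boxq_ideal q \<Longrightarrow> relabel shift_gen p \<in> boxq_ideal q" by auto
qed

lemma rho_class: "rho (boxq_class q p) = boxq_class q (relabel shift_gen p)"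
proof -
  have "\<exists>h'\<in>boxq_ideal q. h = relabel shift_gen h'" if "h \<in> boxq_ideal q" for h
    using that by (metis relabel_ideal relabel_shift_4)
  then show ?thesis
    unfolding rho_def boxq_class_eq using relabel_ideal
    by (force simp: relabel_add image_iff)
qed

lemma rho_boxq_x:
  assumes "j - i = 1 \<or> j - i = 2"
  shows "rho (boxq_x q i j) = boxq_x q (i + 1) (j + 1)"
  using assms by (simp add: boxq_x_def rho_class shift_gen_std)

lemma boxq_automorphism_rho: "boxq_automorphism q rho"
proof -
  have cl: "rho \<zeta> \<in> carrier (boxq q)" if "\<zeta> \<in> carrier (boxq q)" for \<zeta>
    using that by (auto simp: carrier_boxq rho_class)
  have "rho \<in> ring_hom (boxq q) (boxq q)"
    by (rule ring_hom_memI)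
       (auto simp: carrier_boxq rho_class relabel_add relabel_mult
         simp flip: boxq_class_add boxq_class_mult boxq_class_one)
  moreover have "bij_betw rho (carrier (boxq q)) (carrier (boxq q))"
    by (rule bij_betw_byWitness[where f' = "\<lambda>\<zeta>. rho (rho (rho \<zeta>))"])
       (auto simp: cl carrier_boxq rho_class relabel_shift_4)
  moreover have "rho (boxq_smult q c \<zeta>) = boxq_smult q c (rho \<zeta>)"
    if "\<zeta> \<in> carrier (boxq q)" for c \<zeta>
    using that by (auto simp: carrier_boxq boxq_smult_def rho_class relabel_mult
        simp flip: boxq_class_mult)
  ultimately show ?thesis
    by (auto simp: boxq_automorphism_def ring_iso_def)
qed

end

theory Submission
  imports Defs
begin

text \<open>
  Twisting via \<open>\<rho>\<^sup>2\<close> replaces the action of \<open>x\<^sub>i\<^sub>j\<close> by that of \<open>x\<^sub>i\<^sub>+\<^sub>2\<^sub>,\<^sub>j\<^sub>+\<^sub>2\<close>, so the task is to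
  find a linear bijection \<open>F\<close> of \<open>V\<close> that carries every \<open>x\<^sub>i\<^sub>j\<close> to \<open>x\<^sub>i\<^sub>+\<^sub>2\<^sub>,\<^sub>j\<^sub>+\<^sub>2\<close>.  Only the operators
  of the generators on one space are involved, and \<open>F\<close> is found by linear algebra.

  Consider a triangle \<open>A = x\<^sub>a\<^sub>b\<close>, \<open>B = x\<^sub>b\<^sub>c\<close>, \<open>C = x\<^sub>c\<^sub>a\<close> of generators, such as
  \<open>(x\<^sub>0\<^sub>2, x\<^sub>2\<^sub>3, x\<^sub>3\<^sub>0)\<close> or \<open>(x\<^sub>2\<^sub>0, x\<^sub>0\<^sub>1, x\<^sub>1\<^sub>2)\<close>.  They satisfy the cyclic \<open>q\<close>-Weyl relations of
  the equitable presentation of \<open>U\<^sub>q(sl\<^sub>2)\<close>.  On an evaluation module \<open>A\<close> has simple eigenvalues \<open>q\<^sup>d, q\<^sup>d\<^sup>-\<^sup>2, \<dots>\<close>; in an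
  eigenbasis \<open>v\<^sub>0, \<dots>, v\<^sub>d\<close> the operator \<open>B\<close> is lower bidiagonal and \<open>C\<close> upper bidiagonal, with
  known diagonals, and the relation between \<open>B\<close> and \<open>C\<close> fixes the products of opposite
  off-diagonal entries.  These products do not vanish.  Two consequences carry the proof.

  \<^item> Two such triples with the same \<open>d\<close> are conjugate (\<open>triples_isomorphic\<close>): rescaling the basis
    adjusts the entries of \<open>B\<close>, and then those of \<open>C\<close> agree.

  \<^item> In such a triple, \<open>A\<close> and \<open>B\<close> determine \<open>C\<close> (\<open>third_unique\<close>).

  The first gives \<open>F\<close> with \<open>x\<^sub>0\<^sub>2, x\<^sub>2\<^sub>3, x\<^sub>3\<^sub>0 \<mapsto> x\<^sub>2\<^sub>0, x\<^sub>0\<^sub>1, x\<^sub>1\<^sub>2\<close>.  As for \<open>x\<^sub>0\<^sub>1\<close> and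
  \<open>x\<^sub>1\<^sub>2\<close>, the relation between \<open>x\<^sub>1\<^sub>2\<close> and \<open>x\<^sub>2\<^sub>3\<close>, both of which raise the
  eigenbasis of \<open>x\<^sub>0\<^sub>2\<close>, forces \<open>x\<^sub>2\<^sub>3 = x\<^sub>2\<^sub>0 + t (x\<^sub>2\<^sub>0 x\<^sub>1\<^sub>2 - 1)\<close> for a scalar \<open>t \<noteq> 0\<close>
  (\<open>raising_operator_determined\<close>), and likewise \<open>x\<^sub>0\<^sub>1 = x\<^sub>0\<^sub>2 + t' (x\<^sub>0\<^sub>2 x\<^sub>3\<^sub>0 - 1)\<close>.  Comparing
  off-diagonal products at the two ends of the basis gives \<open>t = t'\<close>: this scalar is the
  evaluation parameter, and its invariance under \<open>\<rho>\<^sup>2\<close> is the heart of the matter.  Hence \<open>F\<close>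
  also carries \<open>x\<^sub>0\<^sub>1\<close> to \<open>x\<^sub>2\<^sub>3\<close> and \<open>x\<^sub>1\<^sub>2\<close> to \<open>x\<^sub>3\<^sub>0\<close>.  Finally \<open>x\<^sub>1\<^sub>3\<close> and the conjugate of
  \<open>x\<^sub>3\<^sub>1\<close> by \<open>F\<close> both complete \<open>(x\<^sub>3\<^sub>0, x\<^sub>0\<^sub>1)\<close> to a triple, so they are equal.
  The inverses \<open>x\<^sub>2\<^sub>0\<close> and \<open>x\<^sub>3\<^sub>1\<close> of \<open>x\<^sub>0\<^sub>2\<close> and \<open>x\<^sub>1\<^sub>3\<close> then follow, and with the generators the
  whole algebra.
\<close>

section \<open>The \<open>q\<close>-Weyl relation and scalar identities\<close>

locale q_space = vector_space scale
  for scale :: "'f::field \<Rightarrow> 'v::ab_group_add \<Rightarrow> 'v" (infixr \<open>*s\<close> 75) +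
  fixes q :: 'f
  assumes q_nonzero: "q \<noteq> 0"
    and q_not_root_of_unity: "\<And>n::nat. n > 0 \<Longrightarrow> q ^ n \<noteq> 1"
begin

sublocale vector_space_pair scale scale
  by unfold_locales

abbreviation endo :: "('v \<Rightarrow> 'v) \<Rightarrow> bool" where
  "endo \<equiv> Vector_Spaces.linear scale scale"

definition q_weyl :: "('v \<Rightarrow> 'v) \<Rightarrow> ('v \<Rightarrow> 'v) \<Rightarrow> bool" where
  "q_weyl A B \<longleftrightarrow>
     (\<forall>w. q *s A (B w) - inverse q *s B (A w) = (q - inverse q) *s w)"

lemma q_powi_mult: "q powi m * q powi n = q powi (m + n)"
  using q_nonzero by (simp add: power_int_add)

lemma q_powi_eq_1_iff: "q powi n = 1 \<longleftrightarrow> n = 0"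
proof
  assume n: "q powi n = 1"
  have "q ^ nat \<bar>n\<bar> = 1"
  proof (cases "n \<ge> 0")
    case True then show ?thesis using n by (simp add: power_int_def)
  next
    case False then show ?thesis using n by (simp add: power_int_def power_inverse)
  qed
  then show "n = 0" using q_not_root_of_unity[of "nat \<bar>n\<bar>"] by fastforce
qed simp

lemma q_powi_inj: "q powi m = q powi n \<longleftrightarrow> m = n"
proof -
  have "q powi m = q powi n \<longleftrightarrow> q powi (m - n) = 1"
    using q_nonzero by (simp add: power_int_diff)
  then show ?thesis using q_powi_eq_1_iff[of "m - n"] by simp
qed

lemma q_minus_inverse_nonzero: "q - inverse q \<noteq> 0"
proof
  assume "q - inverse q = 0"
  then have "q powi 1 = q powi (-1)" by (simp add: power_int_minus)
  then show False unfolding q_powi_inj by simp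
qed

definition wt :: "nat \<Rightarrow> int \<Rightarrow> 'f" where
  "wt d n = q powi (int d - 2 * n)"

lemma wt_nonzero [simp]: "wt d n \<noteq> 0"
  using q_nonzero by (simp add: wt_def)

lemma wt_inj: "wt d m = wt d n \<longleftrightarrow> m = n"
  by (simp add: wt_def q_powi_inj)

lemma wt_plus1: "q * wt d (n + 1) = inverse q * wt d n"
proof -
  have "wt d n = q powi 2 * wt d (n + 1)"
    unfolding wt_def using q_nonzero by (subst power_int_add[symmetric]) auto
  then show ?thesis using q_nonzero by (simp add: power2_eq_square)
qed

lemma wt_minus1: "q * wt d n = inverse q * wt d (n - 1)"
  using wt_plus1[of d "n - 1"] by simp

lemma wt_reflect: "wt d (int d - n) = inverse (wt d n)"
  by (simp add: wt_def power_int_minus[symmetric])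

text \<open>
  If \<open>v\<close> is an eigenvector of \<open>A\<close>, a relation \<open>a A B - b B A = a - b\<close> makes \<open>B v\<close> a solution of
  an inhomogeneous linear equation with the particular solution \<open>\<nu>\<^sup>-\<^sup>1 v\<close>; the homogeneous
  equation says that the difference is an eigenvector for \<open>(b / a) \<nu>\<close>.  The scalars are general because
  both orders of a \<open>q\<close>-Weyl pair are needed: \<open>(a, b)\<close> is \<open>(q, q\<^sup>-\<^sup>1)\<close> or \<open>(-q\<^sup>-\<^sup>1, -q)\<close>.
\<close>

lemma eigenvector_shift:
  assumes A: "endo A" and v: "A v = \<nu> *s v" and "a \<noteq> 0" "\<nu> \<noteq> 0"
    and comm: "a *s A (B v) - b *s B (A v) = (a - b) *s v" and B: "endo B"
    and \<mu>: "a * \<mu> = b * \<nu>"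
  shows "A (B v - inverse \<nu> *s v) = \<mu> *s (B v - inverse \<nu> *s v)"
proof -
  have "a *s A (B v) = (a - b) *s v + (b * \<nu>) *s B v"
    using comm by (simp add: v linear_scale[OF B] diff_eq_eq)
  then have "a *s A (B v - inverse \<nu> *s v) = (a * \<mu>) *s (B v - inverse \<nu> *s v)"
    using \<open>\<nu> \<noteq> 0\<close>
    by (simp add: v linear_diff[OF A] linear_scale[OF A] scale_right_diff_distrib
        scale_left_diff_distrib \<mu>)
  then have "a *s (A (B v - inverse \<nu> *s v)) = a *s (\<mu> *s (B v - inverse \<nu> *s v))"
    by simp
  then show ?thesis using \<open>a \<noteq> 0\<close> by (simp only: scale_cancel_left) simp
qed

text \<open>
  The product of the entries of the two other members of an equitable triple that lead from
  \<open>v\<^sub>n\<^sub>-\<^sub>1\<close> to \<open>v\<^sub>n\<close> and back, where the \<open>v\<^sub>n\<close> are the weight vectors of the first.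
  It vanishes at \<open>n = 0\<close> and \<open>n = d + 1\<close>, where the step would leave the basis.
\<close>

definition step_product :: "nat \<Rightarrow> int \<Rightarrow> 'f" where
  "step_product d n = (1 - q powi (2 * n)) * (1 - q powi (2 * n - 2 * int d - 2))"

lemma step_product_0 [simp]: "step_product d 0 = 0" by (simp add: step_product_def)

lemma step_product_recursion:
  "(q - inverse q) * inverse (wt d n) * inverse (wt d n) + q * step_product d n
     - inverse q * step_product d (n + 1) = q - inverse q"
proof -
  define x y where "x = q powi (2 * n)" and "y = q powi (- 2 * int d)"
  have w: "inverse (wt d n) * inverse (wt d n) = x * x * y"
    unfolding wt_def x_def y_def using q_nonzero
    by (simp add: power_int_add[symmetric] power_int_minus[symmetric])
  have x1: "q powi (2 * (n + 1)) = q * q * x"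
    unfolding x_def using q_nonzero
    by (simp add: power_int_add distrib_left power2_eq_square)
  have y1: "q powi (2 * (n + 1) - 2 * int d - 2) = x * y"
    unfolding x_def y_def using q_nonzero by (simp add: power_int_add[symmetric])
  have y0: "q * q * q powi (2 * n - 2 * int d - 2) = x * y"
    using q_powi_mult[of 2 "2 * n - 2 * int d - 2"] q_powi_mult[of "2 * n" "- 2 * int d"]
    by (simp add: x_def y_def power2_eq_square)
  then have y0': "q powi (2 * n - 2 * int d - 2) = x * y * inverse q * inverse q"
    using q_nonzero by (simp add: field_simps)
  show ?thesis
    unfolding step_product_def x1 y1 y0' mult.assoc[of "q - inverse q"] w x_def[symmetric]
    using q_nonzero by (simp add: field_simps)
qed

lemma step_product_nonzero: "1 \<le> n \<Longrightarrow> n \<le> int d \<Longrightarrow> step_product d n \<noteq> 0"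
  using q_powi_eq_1_iff[of "2 * n"] q_powi_eq_1_iff[of "2 * n - 2 * int d - 2"]
  by (simp add: step_product_def)

text \<open>
  This comparison of the two extreme steps makes the evaluation parameter invariant under a half
  turn.
\<close>

lemma step_product_ends: "step_product d (int d) = q powi (2 * int d - 2) * step_product d 1"
proof -
  define x y u where "x = q powi (2 * int d)" and "y = q powi (- (2 * int d))"
    and "u = q powi (- 2)"
  have xy: "x * y = 1" and u: "q powi 2 * u = 1" and xu: "q powi (2 * int d - 2) = x * u"
    unfolding x_def y_def u_def q_powi_mult by simp_all
  have ends: "step_product d (int d) = (1 - x) * (1 - u)" "step_product d 1 = (1 - q powi 2) * (1 - y)"
    by (simp_all add: step_product_def x_def y_def u_def)
  have "x * u * ((1 - q powi 2) * (1 - y)) = (x - x * y) * (u - q powi 2 * u)"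
    by (simp add: algebra_simps)
  also have "\<dots> = (1 - x) * (1 - u)"
    unfolding xy u by (simp add: algebra_simps)
  finally show ?thesis unfolding xu ends by simp
qed

end

section \<open>Bases of weight vectors\<close>

text \<open>
  The weight vectors are indexed by all integers and vanish outside \<open>0, \<dots>, d\<close>.  The condition on
  eigenvectors then says both that the eigenspaces are lines for \<open>0 \<le> n \<le> d\<close> and that there are no
  eigenvectors for the other powers \<open>q\<^sup>d\<^sup>-\<^sup>2\<^sup>n\<close>, so raising and lowering need no case distinction at the
  ends.
\<close>

locale weight_basis = q_space scale q
  for scale :: "'f::field \<Rightarrow> 'v::ab_group_add \<Rightarrow> 'v" (infixr \<open>*s\<close> 75) and q :: 'f +
  fixes d :: nat and A :: "'v \<Rightarrow> 'v" and v :: "int \<Rightarrow> 'v"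
  assumes linear_A: "Vector_Spaces.linear scale scale A"
    and A_v: "A (v n) = wt d n *s v n"
    and weight_space: "A w = wt d n *s w \<Longrightarrow> \<exists>c. w = c *s v n"
    and v_nonzero_iff: "v n \<noteq> 0 \<longleftrightarrow> 0 \<le> n \<and> n \<le> int d"
    and span_v: "span (range v) = UNIV"
begin

lemma endo_eqI:
  assumes "endo F" "endo G" "\<And>n. 0 \<le> n \<Longrightarrow> n \<le> int d \<Longrightarrow> F (v n) = G (v n)"
  shows "F = G"
proof
  fix w
  have "F (v n) = G (v n)" for n
    using assms v_nonzero_iff[of n] by (cases "v n = 0") (auto simp: linear_0)
  then show "F w = G w"
    using linear_eq_on[OF assms(1,2), of w "range v"] span_v by auto
qed

text \<open>
  Eigenvectors for distinct eigenvalues are independent: if \<open>w = k v\<^sub>m + w'\<close>, then \<open>A - \<nu>\<^sub>m\<close>,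
  where \<open>\<nu>\<^sub>m\<close> is the eigenvalue of \<open>v\<^sub>m\<close>, multiplies \<open>w\<close> by a nonzero scalar and moves it into the
  span of fewer weight vectors.
\<close>

lemma no_other_eigenvector:
  assumes "finite N" and "w \<in> span (v ` N)" "A w = \<mu> *s w" "\<mu> \<notin> wt d ` N"
  shows "w = 0"
  using assms
proof (induction N arbitrary: w rule: finite_induct)
  case empty then show ?case by simp
next
  case (insert m N)
  then obtain k where k: "w - k *s v m \<in> span (v ` N)"
    by (auto simp: span_breakdown_eq)
  define u where "u = (\<mu> - wt d m) *s w"
  have inv: "A x \<in> span (v ` N)" if "x \<in> span (v ` N)" for x
    using that
  proof (induction rule: span_induct_alt)
    case base then show ?case by (simp add: linear_0[OF linear_A] span_zero)
  next
    case (step c x y)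
    then show ?case
      using span_scale[OF span_base, of _ "v ` N"]
      by (auto simp: linear_add[OF linear_A] linear_scale[OF linear_A] A_v intro!: span_add)
  qed
  have "u = A (w - k *s v m) - wt d m *s (w - k *s v m)"
    by (simp add: u_def linear_diff[OF linear_A] linear_scale[OF linear_A] A_v insert.prems
        scale_right_diff_distrib scale_left_diff_distrib scale_left_commute mult.commute)
  also have "\<dots> \<in> span (v ` N)"
    by (intro span_diff span_scale inv k)
  finally have "u \<in> span (v ` N)" .
  moreover have "A u = \<mu> *s u"
    by (simp add: u_def linear_scale[OF linear_A] insert.prems mult.commute)
  ultimately have "u = 0" using insert by auto
  then show ?case using insert.prems by (auto simp: u_def)
qed

lemma inj_v: "inj_on v {0..int d}"
proof
  fix m n assume mn: "m \<in> {0..int d}" "n \<in> {0..int d}" "v m = v n"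
  then have "wt d m *s v m = wt d n *s v m" by (metis A_v)
  then show "m = n" using mn v_nonzero_iff[of m] by (simp add: wt_inj)
qed

lemma independent_v: "independent (v ` {0..int d})"
  unfolding dependent_def
proof safe
  fix n assume n: "n \<in> {0..int d}"
    and "v n \<in> span (v ` {0..int d} - {v n})"
  moreover have "v ` {0..int d} - {v n} \<subseteq> v ` ({0..int d} - {n})" by auto
  ultimately have "v n \<in> span (v ` ({0..int d} - {n}))"
    using span_mono by blast
  then have "v n = 0"
    by (rule no_other_eigenvector[rotated]) (auto simp: A_v wt_inj)
  then show False using n v_nonzero_iff by auto
qed

lemma extend_to_endo:
  assumes "\<And>n. v n = 0 \<Longrightarrow> w n = 0"
  obtains F where "endo F" "\<And>n. F (v n) = w n"
proof -
  obtain F where F: "endo F"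
      "\<forall>x \<in> v ` {0..int d}. F x = w (inv_into {0..int d} v x)"
    using linear_independent_extend[OF independent_v,
        of "\<lambda>x. w (inv_into {0..int d} v x)"] by blast
  have "F (v n) = w n" for n
  proof (cases "n \<in> {0..int d}")
    case True then show ?thesis using F(2) inj_v by simp
  next
    case False
    then have "v n = 0" using v_nonzero_iff by auto
    then show ?thesis using assms linear_0[OF F(1)] by simp
  qed
  with F(1) that show ?thesis by blast
qed

lemma raising:
  assumes B: "endo B" and AB: "q_weyl A B"
  obtains \<beta> where "\<And>n. B (v n) = inverse (wt d n) *s v n + \<beta> n *s v (n + 1)"
proof -
  have "\<exists>k. B (v n) = inverse (wt d n) *s v n + k *s v (n + 1)" for n
  proof -
    have "A (B (v n) - inverse (wt d n) *s v n)
        = wt d (n + 1) *s (B (v n) - inverse (wt d n) *s v n)"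
      by (rule eigenvector_shift[OF linear_A A_v q_nonzero _ _ B wt_plus1])
        (use AB in \<open>simp_all add: q_weyl_def\<close>)
    then show ?thesis using weight_space by (metis add.commute diff_eq_eq)
  qed
  then show ?thesis using that by metis
qed

lemma lowering:
  assumes C: "endo C" and CA: "q_weyl C A"
  obtains \<gamma> where "\<And>n. C (v n) = inverse (wt d n) *s v n + \<gamma> n *s v (n - 1)"
proof -
  have "\<exists>k. C (v n) = inverse (wt d n) *s v n + k *s v (n - 1)" for n
  proof -
    have "A (C (v n) - inverse (wt d n) *s v n)
        = wt d (n - 1) *s (C (v n) - inverse (wt d n) *s v n)"
      by (rule eigenvector_shift[OF linear_A A_v, of "- inverse q" n C "- q"])
        (use CA C q_nonzero in \<open>simp_all add: q_weyl_def wt_minus1\<close>)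
    then show ?thesis using weight_space by (metis add.commute diff_eq_eq)
  qed
  then show ?thesis using that by metis
qed

text \<open>
  The coefficient of \<open>v\<^sub>n\<close> in the \<open>q\<close>-Weyl relation between \<open>B\<close> and \<open>C\<close> is a first-order recursion for
  the products of opposite entries; it starts at zero because \<open>v\<^sub>-\<^sub>1 = 0\<close>.
\<close>

lemma coefficient_product:
  assumes B: "endo B" and C: "endo C" and BC: "q_weyl B C"
    and Bv: "\<And>n. B (v n) = inverse (wt d n) *s v n + \<beta> n *s v (n + 1)"
    and Cv: "\<And>n. C (v n) = inverse (wt d n) *s v n + \<gamma> n *s v (n - 1)"
    and "0 \<le> n" "n \<le> int d + 1"
  shows "\<beta> (n - 1) * \<gamma> n = step_product d n"
proof -
  have step: "(q - inverse q) * inverse (wt d n) * inverse (wt d n) + q * (\<beta> (n - 1) * \<gamma> n)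
     - inverse q * (\<beta> n * \<gamma> (n + 1)) = q - inverse q" (is "?s = _")
    if "0 \<le> n" "n \<le> int d" for n
  proof -
    let ?w = "inverse (wt d n)" and ?up = "inverse (wt d (n + 1))"
      and ?dn = "inverse (wt d (n - 1))"
    have "q *s B (C (v n)) - inverse q *s C (B (v n))
       = ?s *s v n + (\<beta> n * (q * ?w - inverse q * ?up)) *s v (n + 1)
         + (\<gamma> n * (q * ?dn - inverse q * ?w)) *s v (n - 1)"
      by (simp add: Bv Cv linear_add[OF B] linear_add[OF C] linear_scale[OF B] linear_scale[OF C]
          scale_right_distrib scale_left_distrib scale_right_diff_distrib scale_left_diff_distrib
          algebra_simps)
    also have "q * ?w - inverse q * ?up = 0"
      using wt_plus1[of d n] q_nonzero by (simp add: field_simps)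
    also have "q * ?dn - inverse q * ?w = 0"
      using wt_minus1[of d n] q_nonzero by (simp add: field_simps)
    finally have "?s *s v n = (q - inverse q) *s v n"
      using BC by (simp only: q_weyl_def mult_zero_right scale_zero_left add_0_right)
    then show ?thesis using that v_nonzero_iff[of n] by (simp only: scale_cancel_right) blast
  qed
  have cancel: "b = c" if "a - b = a - c" for a b c :: 'f
    using that by simp
  have base: "\<beta> (- 1) = 0"
    using Bv[of "- 1"] v_nonzero_iff[of "-1"] v_nonzero_iff[of 0] by (simp add: linear_0[OF B])
  have "\<beta> (int k - 1) * \<gamma> (int k) = step_product d (int k)" if "k \<le> d + 1" for k
    using that
  proof (induction k)
    case 0 then show ?case by (simp add: base)
  next
    case (Suc k)
    have IH: "\<beta> (int k - 1) * \<gamma> (int k) = step_product d (int k)" using Suc by simp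
    have "inverse q * (\<beta> (int k) * \<gamma> (int k + 1)) = inverse q * step_product d (int k + 1)"
      using Suc.prems
      by (intro cancel[OF trans[OF step[of "int k", unfolded IH] step_product_recursion[of d "int k", symmetric]]])
        simp_all
    then have "\<beta> (int k) * \<gamma> (int k + 1) = step_product d (int k + 1)" using q_nonzero by simp
    then show ?case by (simp add: add.commute)
  qed
  from this[of "nat n"] assms show ?thesis by simp
qed

lemma reflected:
  assumes A': "endo A'" and AA': "\<And>w. A (A' w) = w" and A'A: "\<And>w. A' (A w) = w"
  shows "weight_basis scale q d A' (\<lambda>n. v (int d - n))"
proof (intro weight_basis.intro weight_basis_axioms.intro q_space_axioms)
  show "endo A'" by fact
  show "A' (v (int d - n)) = wt d n *s v (int d - n)" for n
  proof -
    have "v (int d - n) = A' (inverse (wt d n) *s v (int d - n))"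
      using A'A[of "v (int d - n)"] by (simp add: A_v wt_reflect)
    then show ?thesis
      by (metis linear_scale[OF A'] scale_scale right_inverse scale_one wt_nonzero)
  qed
  show "\<exists>c. w = c *s v (int d - n)" if "A' w = wt d n *s w" for w n
  proof (rule weight_space)
    have "w = wt d n *s A w" by (metis AA' linear_scale[OF linear_A] that)
    then have "inverse (wt d n) *s w = (inverse (wt d n) * wt d n) *s A w"
      by (metis scale_scale)
    then show "A w = wt d (int d - n) *s w" by (simp add: wt_reflect)
  qed
  show "v (int d - n) \<noteq> 0 \<longleftrightarrow> 0 \<le> n \<and> n \<le> int d" for n
    using v_nonzero_iff[of "int d - n"] by auto
  have "range (\<lambda>n. v (int d - n)) = range v"
    by (force simp: image_def intro: exI[of _ "int d - _"])
  then show "span (range (\<lambda>n. v (int d - n))) = UNIV" using span_v by simp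
qed


text \<open>
  Two operators that both raise the weight basis are tied together by the top coefficient, that of
  \<open>v\<^sub>n\<^sub>+\<^sub>2\<close>, of the \<open>q\<close>-Weyl relation between them.  It leaves a single free scalar \<open>t\<close>.
\<close>

lemma raising_ratio:
  assumes B: "endo B" and G: "endo G"
    and Bv: "\<And>n. B (v n) = inverse (wt d n) *s v n + \<beta> n *s v (n + 1)"
    and Gv: "\<And>n. G (v n) = wt d n *s v n + g n *s v (n + 1)"
    and GB: "q_weyl G B"
    and g: "\<And>n. 0 \<le> n \<Longrightarrow> n < int d \<Longrightarrow> g n \<noteq> 0"
    and n: "0 \<le> n" "n < int d"
  defines "t \<equiv> \<beta> 0 * wt d 1 / g 0"
  shows "\<beta> n = t * inverse (wt d (n + 1)) * g n"
proof -
  have step: "q * (\<beta> n * g (n + 1)) = inverse q * (\<beta> (n + 1) * g n)"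
    if "0 \<le> n" "n + 2 \<le> int d" for n
  proof -
    let ?s = "q * (\<beta> n * g (n + 1)) - inverse q * (\<beta> (n + 1) * g n)"
    have "q *s G (B (v n)) - inverse q *s B (G (v n))
       = ((q - inverse q) * (wt d n * inverse (wt d n))) *s v n
         + (g n * (q * inverse (wt d n) - inverse q * inverse (wt d (n + 1)))
            + \<beta> n * (q * wt d (n + 1) - inverse q * wt d n)) *s v (n + 1)
         + ?s *s v (n + 1 + 1)"
      by (simp only: Bv Gv linear_add[OF B] linear_add[OF G] linear_scale[OF B] linear_scale[OF G])
        (simp add: scale_right_distrib scale_left_distrib scale_right_diff_distrib
          scale_left_diff_distrib algebra_simps del: right_inverse left_inverse)
    also have "q * inverse (wt d n) - inverse q * inverse (wt d (n + 1)) = 0"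
      using wt_plus1[of d n] q_nonzero by (simp add: field_simps)
    also have "q * wt d (n + 1) - inverse q * wt d n = 0"
      using wt_plus1[of d n] by simp
    finally have "?s *s v (n + 1 + 1) = 0"
      using GB by (simp add: q_weyl_def)
    then show ?thesis using that v_nonzero_iff[of "n + 1 + 1"] by auto
  qed
  have ratio: "\<beta> (int k) = t * inverse (wt d (int k + 1)) * g (int k)" if "k < d" for k
    using that
  proof (induction k)
    case 0
    then show ?case using g[of 0] n by (simp add: t_def)
  next
    case (Suc k)
    have w: "inverse (wt d (int k + 1 + 1)) = q * q * inverse (wt d (int k + 1))"
      using wt_plus1[of d "int k + 1"] q_nonzero by (simp add: field_simps)
    have "\<beta> (int k + 1) * g (int k) = q * q * \<beta> (int k) * g (int k + 1)"
      using step[of "int k"] Suc.prems q_nonzero by (simp add: field_simps)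
    then have "\<beta> (int k + 1) = t * inverse (wt d (int k + 1 + 1)) * g (int k + 1)"
      using Suc g[of "int k"] unfolding w by simp
    then show ?case by (simp add: add.commute)
  qed
  from this[of "nat n"] n show ?thesis by simp
qed

text \<open>
  The basis-free form of the proportionality of entries: \<open>A' G - 1\<close> kills the diagonal of \<open>G\<close> and
  leaves just the raising entries to which those of \<open>B\<close> are proportional.  A conjugation that respects \<open>A'\<close> and \<open>G\<close> therefore respects \<open>B\<close>.
\<close>

lemma raising_operator_determined:
  assumes A': "endo A'" "\<And>w. A' (A w) = w" and B: "endo B" and G: "endo G"
    and Bv: "\<And>n. B (v n) = inverse (wt d n) *s v n + \<beta> n *s v (n + 1)"
    and Gv: "\<And>n. G (v n) = wt d n *s v n + g n *s v (n + 1)"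
    and ratio: "\<And>n. 0 \<le> n \<Longrightarrow> n < int d \<Longrightarrow> \<beta> n = t * inverse (wt d (n + 1)) * g n"
  shows "B w = A' w + t *s (A' (G w) - w)"
proof -
  have A'v: "A' (v n) = inverse (wt d n) *s v n" for n
  proof -
    have "v n = wt d n *s A' (v n)"
      using A'(2)[of "v n"] by (simp add: A_v linear_scale[OF A'(1)])
    then have "inverse (wt d n) *s v n = (inverse (wt d n) * wt d n) *s A' (v n)"
      by (metis scale_scale)
    then show ?thesis by simp
  qed
  have "B = (\<lambda>w. A' w + t *s (A' (G w) - w))"
  proof (rule endo_eqI[OF B])
    show "endo (\<lambda>w. A' w + t *s (A' (G w) - w))"
      by (rule linear_compose_add[OF A'(1) linear_compose_scale_right[OF linear_compose_sub
            [OF Vector_Spaces.linear_compose[OF G A'(1), unfolded o_def] linear_ident]]])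
    fix n assume n: "0 \<le> n" "n \<le> int d"
    show "B (v n) = A' (v n) + t *s (A' (G (v n)) - v n)"
    proof (cases "n = int d")
      case True
      then have "v (n + 1) = 0" using v_nonzero_iff[of "n + 1"] by auto
      then show ?thesis by (simp add: Bv Gv A'v linear_scale[OF A'(1)])
    next
      case False
      then show ?thesis using ratio[of n] n
        by (simp add: Bv Gv A'v linear_scale[OF A'(1)] linear_add[OF A'(1)] mult_ac)
    qed
  qed
  then show ?thesis by metis
qed

end

section \<open>Equitable triples\<close>

locale equitable_triple = weight_basis scale q d A v
  for scale :: "'f::field \<Rightarrow> 'v::ab_group_add \<Rightarrow> 'v" (infixr \<open>*s\<close> 75) and q :: 'f
    and d A v +
  fixes B C :: "'v \<Rightarrow> 'v"
  assumes linear_B: "Vector_Spaces.linear scale scale B"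
    and linear_C: "Vector_Spaces.linear scale scale C"
    and AB: "q_weyl A B" and BC: "q_weyl B C" and CA: "q_weyl C A"
begin

lemma coefficients:
  obtains \<beta> \<gamma> where
    "\<And>n. B (v n) = inverse (wt d n) *s v n + \<beta> n *s v (n + 1)"
    "\<And>n. C (v n) = inverse (wt d n) *s v n + \<gamma> n *s v (n - 1)"
    "\<And>n. 0 \<le> n \<Longrightarrow> n \<le> int d + 1 \<Longrightarrow> \<beta> (n - 1) * \<gamma> n = step_product d n"
proof -
  obtain \<beta> where \<beta>: "\<And>n. B (v n) = inverse (wt d n) *s v n + \<beta> n *s v (n + 1)"
    using raising[OF linear_B AB] by blast
  obtain \<gamma> where \<gamma>: "\<And>n. C (v n) = inverse (wt d n) *s v n + \<gamma> n *s v (n - 1)"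
    using lowering[OF linear_C CA] by blast
  show ?thesis
    by (rule that[OF \<beta> \<gamma>]) (rule coefficient_product[OF linear_B linear_C BC \<beta> \<gamma>])
qed

text \<open>
  The entries of \<open>B\<close> are nonzero and the products with those of \<open>C\<close> are prescribed, so \<open>C\<close> has no
  freedom left.
\<close>

lemma third_unique:
  assumes C': "endo C'" and BC': "q_weyl B C'" and C'A: "q_weyl C' A"
  shows "C' = C"
proof -
  obtain \<beta> \<gamma> where \<beta>: "\<And>n. B (v n) = inverse (wt d n) *s v n + \<beta> n *s v (n + 1)"
    and \<gamma>: "\<And>n. C (v n) = inverse (wt d n) *s v n + \<gamma> n *s v (n - 1)"
    and P: "\<And>n. 0 \<le> n \<Longrightarrow> n \<le> int d + 1 \<Longrightarrow> \<beta> (n - 1) * \<gamma> n = step_product d n"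
    using coefficients by blast
  obtain \<gamma>' where \<gamma>': "\<And>n. C' (v n) = inverse (wt d n) *s v n + \<gamma>' n *s v (n - 1)"
    using lowering[OF C' C'A] by blast
  note P' = coefficient_product[OF linear_B C' BC' \<beta> \<gamma>']
  show ?thesis
  proof (rule endo_eqI[OF C' linear_C])
    fix n assume n: "0 \<le> n" "n \<le> int d"
    have "\<gamma> n = \<gamma>' n \<or> v (n - 1) = 0"
    proof (cases "n = 0")
      case True then show ?thesis using v_nonzero_iff[of "n - 1"] by auto
    next
      case False
      then have "\<beta> (n - 1) * \<gamma> n = \<beta> (n - 1) * \<gamma>' n" "\<beta> (n - 1) * \<gamma> n \<noteq> 0"
        using P[of n] P'[of n] step_product_nonzero[of n d] n by auto
      then show ?thesis by simp
    qed
    then show "C' (v n) = C (v n)" by (auto simp: \<gamma> \<gamma>')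
  qed
qed

end

text \<open>
  The conjugating map sends \<open>v\<^sub>n\<close> to a multiple of \<open>v'\<^sub>n\<close>.  The multiples are chosen to match \<open>B\<close>
  with \<open>B'\<close>; because the products of opposite entries agree, \<open>C\<close> and \<open>C'\<close> then match as well.
\<close>

lemma (in q_space) triples_isomorphic:
  assumes "equitable_triple scale q d A v B C" and "equitable_triple scale q d A' v' B' C'"
  obtains F G where "endo F" "endo G" "\<And>w. F (G w) = w" "\<And>w. G (F w) = w"
    "\<And>w. F (A w) = A' (F w)" "\<And>w. F (B w) = B' (F w)" "\<And>w. F (C w) = C' (F w)"
proof -
  interpret T: equitable_triple scale q d A v B C by fact
  interpret T': equitable_triple scale q d A' v' B' C' by fact
  obtain \<beta> \<gamma> where \<beta>: "\<And>n. B (v n) = inverse (wt d n) *s v n + \<beta> n *s v (n + 1)"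
    and \<gamma>: "\<And>n. C (v n) = inverse (wt d n) *s v n + \<gamma> n *s v (n - 1)"
    and P: "\<And>n. 0 \<le> n \<Longrightarrow> n \<le> int d + 1 \<Longrightarrow> \<beta> (n - 1) * \<gamma> n = step_product d n"
    using T.coefficients by blast
  obtain \<beta>' \<gamma>' where \<beta>': "\<And>n. B' (v' n) = inverse (wt d n) *s v' n + \<beta>' n *s v' (n + 1)"
    and \<gamma>': "\<And>n. C' (v' n) = inverse (wt d n) *s v' n + \<gamma>' n *s v' (n - 1)"
    and P': "\<And>n. 0 \<le> n \<Longrightarrow> n \<le> int d + 1 \<Longrightarrow> \<beta>' (n - 1) * \<gamma>' n = step_product d n"
    using T'.coefficients by blast
  have nz: "\<beta> n \<noteq> 0" "\<beta>' n \<noteq> 0" if "0 \<le> n" "n < int d" for n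
    using P[of "n + 1"] P'[of "n + 1"] step_product_nonzero[of "n + 1" d] that by auto
  define c where "c n = (\<Prod>i\<in>{0..<n}. \<beta>' i / \<beta> i)" for n
  have c_nz: "c n \<noteq> 0" if "n \<le> int d" for n
    using that nz by (auto simp: c_def)
  have c_step: "\<beta> n * c (n + 1) = c n * \<beta>' n" if "0 \<le> n" "n < int d" for n
  proof -
    have "{0..<n + 1} = insert n {0..<n}" using that by auto
    then show ?thesis using nz[OF that] by (simp add: c_def)
  qed
  have zero: "v n = 0 \<longleftrightarrow> v' n = 0" for n
    using T.v_nonzero_iff T'.v_nonzero_iff by blast
  obtain F where F: "endo F" "\<And>n. F (v n) = c n *s v' n"
    by (rule T.extend_to_endo[of "\<lambda>n. c n *s v' n"]) (auto simp: zero)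
  obtain G where G: "endo G" "\<And>n. G (v' n) = inverse (c n) *s v n"
    by (rule T'.extend_to_endo[of "\<lambda>n. inverse (c n) *s v n"]) (auto simp: zero)
  note endo_comp = Vector_Spaces.linear_compose[unfolded o_def]
  note lin = linear_add[OF F(1)] linear_scale[OF F(1)] linear_scale[OF G(1)]
    linear_scale[OF T'.linear_A] linear_scale[OF T'.linear_B] linear_scale[OF T'.linear_C]
  have "(\<lambda>w. F (G w)) = (\<lambda>w. w)"
    by (rule T'.endo_eqI[OF endo_comp[OF G(1) F(1)] linear_ident])
      (simp add: F G lin c_nz)
  moreover have "(\<lambda>w. G (F w)) = (\<lambda>w. w)"
    by (rule T.endo_eqI[OF endo_comp[OF F(1) G(1)] linear_ident])
      (simp add: F G lin c_nz)
  moreover have "(\<lambda>w. F (A w)) = (\<lambda>w. A' (F w))"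
    by (rule T.endo_eqI[OF endo_comp[OF T.linear_A F(1)] endo_comp[OF F(1) T'.linear_A]])
      (simp add: F lin T.A_v T'.A_v mult.commute)
  moreover have "(\<lambda>w. F (B w)) = (\<lambda>w. B' (F w))"
  proof (rule T.endo_eqI[OF endo_comp[OF T.linear_B F(1)] endo_comp[OF F(1) T'.linear_B]])
    fix n assume n: "0 \<le> n" "n \<le> int d"
    have "\<beta> n * c (n + 1) = c n * \<beta>' n \<or> v' (n + 1) = 0"
      using c_step[of n] n T'.v_nonzero_iff[of "n + 1"] by fastforce
    then show "F (B (v n)) = B' (F (v n))"
      by (auto simp: F lin \<beta> \<beta>' scale_right_distrib mult.commute)
  qed
  moreover have "(\<lambda>w. F (C w)) = (\<lambda>w. C' (F w))"
  proof (rule T.endo_eqI[OF endo_comp[OF T.linear_C F(1)] endo_comp[OF F(1) T'.linear_C]])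
    fix n assume n: "0 \<le> n" "n \<le> int d"
    have "\<gamma> n * c (n - 1) = c n * \<gamma>' n \<or> v' (n - 1) = 0"
    proof (cases "n = 0")
      case True then show ?thesis using T'.v_nonzero_iff[of "n - 1"] by auto
    next
      case False
      then have "\<beta> (n - 1) * c n = c (n - 1) * \<beta>' (n - 1)"
        "\<beta> (n - 1) * \<gamma> n = \<beta>' (n - 1) * \<gamma>' n" "\<beta> (n - 1) \<noteq> 0"
        using c_step[of "n - 1"] P[of n] P'[of n] nz[of "n - 1"] n by auto
      then have "\<beta> (n - 1) * \<gamma> n * c (n - 1) = \<gamma>' n * (\<beta> (n - 1) * c n)"
        by (simp only: mult_ac)
      then have "\<beta> (n - 1) * (\<gamma> n * c (n - 1)) = \<beta> (n - 1) * (c n * \<gamma>' n)"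
        by (simp only: mult_ac)
      then show ?thesis using \<open>\<beta> (n - 1) \<noteq> 0\<close> by simp
    qed
    then show "F (C (v n)) = C' (F (v n))"
      by (auto simp: F lin \<gamma> \<gamma>' scale_right_distrib mult.commute)
  qed
  ultimately show ?thesis using that[OF F(1) G(1)] by (simp add: fun_eq_iff)
qed

section \<open>The half turn on the operators of the generators\<close>

text \<open>
  The operators by which the generators act on an evaluation module of diameter \<open>d\<close>, detached from
  the algebra.
\<close>

locale box_operators = q_space scale q
  for scale :: "'f::field \<Rightarrow> 'v::ab_group_add \<Rightarrow> 'v" (infixr \<open>*s\<close> 75) and q :: 'f +
  fixes d :: nat and x :: "4 \<Rightarrow> 4 \<Rightarrow> 'v \<Rightarrow> 'v"
  assumes diameter_pos: "1 \<le> d"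
    and linear_x: "j - i = 1 \<or> j - i = 2 \<Longrightarrow> Vector_Spaces.linear scale scale (x i j)"
    and x_inverse: "j - i = 2 \<Longrightarrow> x i j (x j i w) = w"
    and x_weyl: "(j - i, k - j) \<in> {(1, 1), (1, 2), (2, 1)} \<Longrightarrow> q_weyl (x i j) (x j k)"
    and x_weight_basis: "j - i = 1 \<or> j - i = 2 \<Longrightarrow> \<exists>v. weight_basis scale q d (x i j) v"
begin

lemma half_turn_intertwiner:
  obtains F where "endo F" "bij F"
    "\<And>i j w. j - i = 1 \<or> j - i = 2 \<Longrightarrow> F (x i j w) = x (i + 2) (j + 2) (F w)"
proof -
  have lin: "endo (x 0 1)" "endo (x 1 2)" "endo (x 2 3)" "endo (x 3 0)"
    "endo (x 0 2)" "endo (x 2 0)" "endo (x 1 3)" "endo (x 3 1)"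
    by (rule linear_x; simp)+
  have inv02: "x 0 2 (x 2 0 w) = w" "x 2 0 (x 0 2 w) = w" for w
    by (rule x_inverse; simp)+
  have inv13: "x 1 3 (x 3 1 w) = w" "x 3 1 (x 1 3 w) = w" for w
    by (rule x_inverse; simp)+
  have weyl: "q_weyl (x 0 2) (x 2 3)" "q_weyl (x 2 3) (x 3 0)" "q_weyl (x 3 0) (x 0 2)"
    "q_weyl (x 2 0) (x 0 1)" "q_weyl (x 0 1) (x 1 2)" "q_weyl (x 1 2) (x 2 0)"
    "q_weyl (x 3 0) (x 0 1)" "q_weyl (x 0 1) (x 1 3)" "q_weyl (x 1 3) (x 3 0)"
    "q_weyl (x 1 2) (x 2 3)" "q_weyl (x 2 3) (x 3 1)" "q_weyl (x 3 1) (x 1 2)"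
    by (rule x_weyl; simp)+
  obtain v where "weight_basis scale q d (x 0 2) v"
    using x_weight_basis[of 2 0] by auto
  then interpret W: weight_basis scale q d "x 0 2" v .
  interpret T: equitable_triple scale q d "x 0 2" v "x 2 3" "x 3 0"
    by (intro equitable_triple.intro W.weight_basis_axioms equitable_triple_axioms.intro lin weyl)
  define v' where "v' n = v (int d - n)" for n
  have "weight_basis scale q d (x 2 0) v'"
    using W.reflected[OF lin(6) inv02] by (simp add: v'_def[abs_def])
  then interpret W': weight_basis scale q d "x 2 0" v' .
  interpret T': equitable_triple scale q d "x 2 0" v' "x 0 1" "x 1 2"
    by (intro equitable_triple.intro W'.weight_basis_axioms equitable_triple_axioms.intro lin weyl)
  obtain u where "weight_basis scale q d (x 3 0) u"
    using x_weight_basis[of 0 3] by auto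
  then interpret U: weight_basis scale q d "x 3 0" u .
  interpret S: equitable_triple scale q d "x 3 0" u "x 0 1" "x 1 3"
    by (intro equitable_triple.intro U.weight_basis_axioms equitable_triple_axioms.intro lin weyl)

  obtain \<beta> \<gamma> where \<beta>: "\<And>n. x 2 3 (v n) = inverse (wt d n) *s v n + \<beta> n *s v (n + 1)"
    and \<gamma>: "\<And>n. x 3 0 (v n) = inverse (wt d n) *s v n + \<gamma> n *s v (n - 1)"
    and P: "\<And>n. 0 \<le> n \<Longrightarrow> n \<le> int d + 1 \<Longrightarrow> \<beta> (n - 1) * \<gamma> n = step_product d n"
    using T.coefficients by blast
  obtain \<beta>' \<gamma>' where \<beta>': "\<And>n. x 0 1 (v' n) = inverse (wt d n) *s v' n + \<beta>' n *s v' (n + 1)"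
    and \<gamma>': "\<And>n. x 1 2 (v' n) = inverse (wt d n) *s v' n + \<gamma>' n *s v' (n - 1)"
    and P': "\<And>n. 0 \<le> n \<Longrightarrow> n \<le> int d + 1 \<Longrightarrow> \<beta>' (n - 1) * \<gamma>' n = step_product d n"
    using T'.coefficients by blast
  have nz: "\<gamma> n \<noteq> 0" "\<gamma>' n \<noteq> 0" "\<beta> (n - 1) \<noteq> 0" if "1 \<le> n" "n \<le> int d" for n
    using P[of n] P'[of n] step_product_nonzero[OF that] that by auto
  have G: "x 1 2 (v n) = wt d n *s v n + \<gamma>' (int d - n) *s v (n + 1)" for n
    using \<gamma>'[of "int d - n"] by (simp add: v'_def wt_reflect)
  have G': "x 3 0 (v' n) = wt d n *s v' n + \<gamma> (int d - n) *s v' (n + 1)" for n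
    using \<gamma>[of "int d - n"] by (simp add: v'_def wt_reflect algebra_simps)
  \<comment> \<open>In the eigenbasis of \<open>x\<^sub>0\<^sub>2\<close> both \<open>x\<^sub>2\<^sub>3\<close> and \<open>x\<^sub>1\<^sub>2\<close> raise, in the reversed basis
    both \<open>x\<^sub>0\<^sub>1\<close> and \<open>x\<^sub>3\<^sub>0\<close> do; each pair has its own scalar.\<close>
  define t where "t = \<beta> 0 * wt d 1 / \<gamma>' (int d)"
  have t: "t \<noteq> 0"
    using nz[of 1] nz[of "int d"] diameter_pos by (simp add: t_def)
  define t' where "t' = \<beta>' 0 * wt d 1 / \<gamma> (int d)"
  have ratio: "\<beta> n = t * inverse (wt d (n + 1)) * \<gamma>' (int d - n)"
    if "0 \<le> n" "n < int d" for n
    unfolding t_def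
    using W.raising_ratio[OF lin(3,2) \<beta> G weyl(10) _ that] nz by simp
  have ratio': "\<beta>' n = t' * inverse (wt d (n + 1)) * \<gamma> (int d - n)"
    if "0 \<le> n" "n < int d" for n
    unfolding t'_def
    using W'.raising_ratio[OF lin(1,4) \<beta>' G' weyl(7) _ that] nz by simp
  \<comment> \<open>Both scalars are compared through \<open>\<gamma>' 1 * \<gamma> d\<close>: the last step of the first triple
    contributes \<open>\<gamma> d\<close> and the first step of the second triple contributes \<open>\<gamma>' 1\<close>.\<close>
  have "t' = t"
  proof -
    have w: "wt d 1 = q powi (2 * int d - 2) * wt d (int d)"
      unfolding wt_def q_powi_mult by simp
    have "step_product d (int d) * wt d (int d) = t * (\<gamma>' 1 * \<gamma> (int d))"
      using P[of "int d"] ratio[of "int d - 1"] diameter_pos by (simp add: field_simps)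
    moreover have "step_product d 1 * wt d 1 = t' * (\<gamma>' 1 * \<gamma> (int d))"
      using P'[of 1] ratio'[of 0] diameter_pos by (simp add: field_simps)
    ultimately have "t' * (\<gamma>' 1 * \<gamma> (int d)) = t * (\<gamma>' 1 * \<gamma> (int d))"
      using step_product_ends[of d] by (simp add: w mult_ac) blast
    then show ?thesis using nz[of 1] nz[of "int d"] diameter_pos by simp
  qed
  have x01: "x 0 1 w = x 0 2 w + t *s (x 0 2 (x 3 0 w) - w)" for w
    by (rule W'.raising_operator_determined[OF lin(5) inv02(1) lin(1,4) \<beta>' G'])
      (use ratio' in \<open>simp add: \<open>t' = t\<close>\<close>)
  have x23: "x 2 3 w = x 2 0 w + t *s (x 2 0 (x 1 2 w) - w)" for w
    by (rule W.raising_operator_determined[OF lin(6) inv02(2) lin(3,2) \<beta> G ratio])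
  \<comment> \<open>Since \<open>t\<close> is nonzero, the two formulas can be solved for \<open>x\<^sub>1\<^sub>2\<close> and \<open>x\<^sub>3\<^sub>0\<close>.\<close>
  have tx12: "t *s x 1 2 w = x 0 2 (x 2 3 w) - w + t *s x 0 2 w" for w
    unfolding x23
    by (simp add: linear_add[OF lin(5)] linear_scale[OF lin(5)] linear_diff[OF lin(5)] inv02
        scale_right_diff_distrib)
  have tx30: "t *s x 3 0 w = x 2 0 (x 0 1 w) - w + t *s x 2 0 w" for w
    unfolding x01
    by (simp add: linear_add[OF lin(6)] linear_scale[OF lin(6)] linear_diff[OF lin(6)] inv02
        scale_right_diff_distrib)

  obtain F G where F: "endo F" and G: "endo G" and FG: "\<And>w. F (G w) = w" "\<And>w. G (F w) = w"
    and F02: "\<And>w. F (x 0 2 w) = x 2 0 (F w)" and F23: "\<And>w. F (x 2 3 w) = x 0 1 (F w)"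
    and F30: "\<And>w. F (x 3 0 w) = x 1 2 (F w)"
    using triples_isomorphic[OF T.equitable_triple_axioms T'.equitable_triple_axioms] by blast
  have F20: "F (x 2 0 w) = x 0 2 (F w)" for w
    by (metis F02 inv02)
  have F01: "F (x 0 1 w) = x 2 3 (F w)" for w
    by (simp add: x01 x23 F02 F30 linear_add[OF F] linear_scale[OF F] linear_diff[OF F])
  have "t *s F (x 1 2 w) = t *s x 3 0 (F w)" for w
  proof -
    have "t *s F (x 1 2 w) = F (t *s x 1 2 w)" by (simp add: linear_scale[OF F])
    also have "\<dots> = t *s x 3 0 (F w)"
      unfolding tx12 tx30
      by (simp add: F02 F23 linear_add[OF F] linear_scale[OF F] linear_diff[OF F])
    finally show ?thesis .
  qed
  then have F12: "F (x 1 2 w) = x 3 0 (F w)" for w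
    using t by simp
  have G12: "G (x 1 2 w) = x 3 0 (G w)" for w by (metis F30 FG)
  have G23: "G (x 2 3 w) = x 0 1 (G w)" for w by (metis F01 FG)
  \<comment> \<open>Conjugation by \<open>F\<close> turns \<open>(x\<^sub>1\<^sub>2, x\<^sub>2\<^sub>3, x\<^sub>3\<^sub>1)\<close> into a triple that begins with
    \<open>(x\<^sub>3\<^sub>0, x\<^sub>0\<^sub>1)\<close>, whose only possible third member is \<open>x\<^sub>1\<^sub>3\<close>.\<close>
  have "(\<lambda>w. G (x 3 1 (F w))) = x 1 3"
  proof (rule S.third_unique)
    show "endo (\<lambda>w. G (x 3 1 (F w)))"
      using Vector_Spaces.linear_compose[OF Vector_Spaces.linear_compose[OF F lin(8)] G]
      by (simp add: o_def)
    have "G (q *s x 2 3 (x 3 1 (F w)) - inverse q *s x 3 1 (x 2 3 (F w))) = G ((q - inverse q) *s F w)"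
      for w using weyl(11) by (simp add: q_weyl_def)
    then show "q_weyl (x 0 1) (\<lambda>w. G (x 3 1 (F w)))"
      by (simp add: q_weyl_def linear_diff[OF G] linear_scale[OF G] G23 F01 FG)
    have "G (q *s x 3 1 (x 1 2 (F w)) - inverse q *s x 1 2 (x 3 1 (F w))) = G ((q - inverse q) *s F w)"
      for w using weyl(12) by (simp add: q_weyl_def)
    then show "q_weyl (\<lambda>w. G (x 3 1 (F w))) (x 3 0)"
      by (simp add: q_weyl_def linear_diff[OF G] linear_scale[OF G] G12 F30 FG)
  qed
  then have F13: "F (x 1 3 w) = x 3 1 (F w)" for w
    by (metis FG(1))
  have F31: "F (x 3 1 w) = x 1 3 (F w)" for w
    by (metis F13 inv13)

  show ?thesis
  proof (rule that[OF F])
    show "bij F" by (rule o_bij[of G]) (auto simp: FG)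
    fix i j :: 4 and w
    assume ij: "j - i = 1 \<or> j - i = 2"
    have "i = 0 \<or> i = 1 \<or> i = 2 \<or> i = 3"
    proof (induction i)
      case (of_int z)
      then have "z = 0 \<or> z = 1 \<or> z = 2 \<or> z = 3" by fastforce
      then show ?case by auto
    qed
    moreover have "j = i + 1 \<or> j = i + 2" using ij by (auto simp: algebra_simps)
    moreover have mod4: "(4 :: 4) = 0" "(5 :: 4) = 1" "(6 :: 4) = 2" "(7 :: 4) = 3"
      by simp_all
    ultimately show "F (x i j w) = x (i + 2) (j + 2) (F w)"
      by (elim disjE) (simp_all add: mod4 F01 F12 F23 F30 F02 F20 F13 F31)
  qed
qed

end


section \<open>From modules to operators and back\<close>

lemma free_algebra_induct [case_names const var add mult]:
  fixes p :: "('a, 'b::field) free_algebra"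
  assumes const: "\<And>c. R (free_const c)" and var: "\<And>g. R (free_var g)"
    and add: "\<And>p r. R p \<Longrightarrow> R r \<Longrightarrow> R (p + r)" and mult: "\<And>p r. R p \<Longrightarrow> R r \<Longrightarrow> R (p * r)"
  shows "R p"
proof -
  have word: "R (Poly_Mapping.single (Free_Word gs) c)" for gs c
  proof (induction gs)
    case Nil
    then show ?case using const[of c] by (simp add: free_const_def zero_free_word_def)
  next
    case (Cons g gs)
    have "Poly_Mapping.single (Free_Word (g # gs)) c
        = free_var g * Poly_Mapping.single (Free_Word gs) c"
      by (simp add: free_var_def Poly_Mapping.mult_single plus_free_word_def)
    then show ?case using Cons var mult by metis
  qed
  have "R (\<Sum>w\<in>N. Poly_Mapping.single w (Poly_Mapping.lookup p w))" if "finite N" for N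
    using that
  proof (induction N)
    case empty
    then show ?case using const[of 0] by (simp add: free_const_def)
  next
    case (insert w N)
    have "R (Poly_Mapping.single w (Poly_Mapping.lookup p w))" by (cases w) (simp add: word)
    then show ?case using insert add by simp
  qed
  then show ?thesis using free_algebra_expand[of p] by (metis finite_keys)
qed

context boxq_module
begin

text \<open>
  The module seen as a module over the free algebra, where elements can be written as explicit
  noncommutative polynomials.
\<close>

definition free_act :: "(std_gen, 'f) free_algebra \<Rightarrow> 'v \<Rightarrow> 'v" where
  "free_act p = act (boxq_class q p)"

lemma class_in_carrier [simp]: "boxq_class q p \<in> carrier (boxq q)"
  by (simp add: carrier_boxq)

lemma linear_free_act: "Vector_Spaces.linear scale scale (free_act p)"
  by (simp add: free_act_def act_linear)

lemma free_act_add: "free_act (p + r) v = free_act p v + free_act r v"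
  by (simp add: free_act_def boxq_class_add act_add)

lemma free_act_mult: "free_act (p * r) v = free_act p (free_act r v)"
  by (simp add: free_act_def boxq_class_mult act_mult)

lemma free_act_one: "free_act 1 v = v"
  by (simp add: free_act_def boxq_class_one act_one)

lemma free_act_zero: "free_act 0 v = 0"
  using free_act_add[of 0 0 v] by simp

lemma free_act_diff: "free_act (p - r) v = free_act p v - free_act r v"
  using free_act_add[of "p - r" r v] by simp

lemma free_act_const: "free_act (free_const c) v = c *s v"
proof -
  have "boxq_smult q c (boxq_class q 1) = boxq_class q (free_const c)"
    by (simp add: boxq_smult_def flip: boxq_class_mult)
  then show ?thesis
    using act_smult[OF class_in_carrier, of c 1 v] by (simp add: free_act_def boxq_class_one act_one)
qed

lemma free_act_relator:
  assumes "r \<in> boxq_relators q"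
  shows "free_act r v = 0"
proof -
  interpret I: ideal "boxq_ideal q" ring_of_type_algebra by (rule ideal_boxq_ideal)
  have "r \<in> boxq_ideal q" using assms boxq_relators_subset by blast
  then have "boxq_class q r = boxq_class q 0"
    using I.a_rcos_const[of r] I.a_rcos_const[of 0]
      additive_subgroup.zero_closed[OF I.additive_subgroup_axioms] by (simp add: boxq_class_def)
  then show ?thesis by (simp add: free_act_def free_act_zero[unfolded free_act_def])
qed

lemma free_act_inverse:
  assumes "j - i = 2"
  shows "free_act (free_std i j) (free_act (free_std j i) v) = v"
proof -
  have "free_std i j * free_std j i - 1 \<in> boxq_relators q"
    using assms unfolding boxq_relators_def by blast
  from free_act_relator[OF this, of v] show ?thesis by (simp add: free_act_diff free_act_mult free_act_one)
qed

lemma free_act_weyl: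
  assumes "(j - i, k - j) \<in> {(1, 1), (1, 2), (2, 1)}" and "q - inverse q \<noteq> 0"
  shows "q *s free_act (free_std i j) (free_act (free_std j k) v)
    - inverse q *s free_act (free_std j k) (free_act (free_std i j) v) = (q - inverse q) *s v"
proof -
  let ?u = "q *s free_act (free_std i j) (free_act (free_std j k) v)
    - inverse q *s free_act (free_std j k) (free_act (free_std i j) v)"
  have "free_const (inverse (q - inverse q)) *
        (free_const q * free_std i j * free_std j k
          - free_const (inverse q) * free_std j k * free_std i j) - 1 \<in> boxq_relators q"
    using assms(1) unfolding boxq_relators_def by blast
  from free_act_relator[OF this, of v] have "inverse (q - inverse q) *s ?u = v"
    by (simp only: free_act_diff free_act_mult free_act_one free_act_const) simp
  then have "(q - inverse q) *s v = ((q - inverse q) * inverse (q - inverse q)) *s ?u"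
    by (metis scale_scale)
  then show ?thesis using assms(2) by simp
qed

lemma simple_eigenspace:
  assumes "dim (eigenspace T \<mu>) = 1" and "T v = \<mu> *s v" "v \<noteq> 0" "T w = \<mu> *s w"
  shows "\<exists>c. w = c *s v"
proof -
  obtain B where B: "B \<subseteq> eigenspace T \<mu>" "independent B" "eigenspace T \<mu> \<subseteq> span B"
      "card B = dim (eigenspace T \<mu>)"
    using basis_exists by blast
  then obtain b where "B = {b}" using assms(1) by (metis card_1_singletonE)
  moreover have "v \<in> span B" "w \<in> span B"
    using B(3) assms by (auto simp: eigenspace_def)
  ultimately obtain k l where kl: "v = k *s b" "w = l *s b"
    by (auto simp: span_singleton)
  then have "w = (l / k) *s v" using assms(3) by auto
  then show ?thesis by blast
qed

text \<open>
  Type and shape make each weight space of a generator a line; diagonalizability makes the lines span.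
\<close>

lemma weight_basis_exists:
  assumes Q: "q_space scale q"
    and type: "diameter_and_type d 1" and shape: "has_shape d (replicate (Suc d) 1)"
    and ij: "j - i = 1 \<or> j - i = 2"
  shows "\<exists>v. weight_basis scale q d (act (boxq_x q i j)) v"
proof -
  interpret Q: q_space scale q by fact
  define A where "A = act (boxq_x q i j)"
  have lin: "Vector_Spaces.linear scale scale A"
    by (simp add: A_def boxq_x_def act_linear)
  have diag: "diagonalizable A"
    and ev: "eigenvalues A = {q powi (int d - 2 * int n) | n. n \<le> d}"
    using type ij by (auto simp: diameter_and_type_def A_def)
  have dim1: "dim (eigenspace A (q powi (int d - 2 * int n))) = 1" if "n \<le> d" for n
  proof -
    have "map (\<lambda>n. dim (eigenspace A (q powi (int d - 2 * int n)))) [0..<Suc d]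
        = replicate (Suc d) 1"
      using shape ij unfolding has_shape_def A_def by blast
    from arg_cong[OF this, of "\<lambda>xs. xs ! n"] show ?thesis
      using that by (simp del: upt_Suc replicate_Suc)
  qed
  have ev_wt: "\<mu> \<in> eigenvalues A \<longleftrightarrow> (\<exists>n. 0 \<le> n \<and> n \<le> int d \<and> \<mu> = Q.wt d n)" for \<mu>
    unfolding ev Q.wt_def by (auto intro: exI[of _ "int _"]) (metis nat_0_le nat_le_iff)
  define v where "v n = (if 0 \<le> n \<and> n \<le> int d
      then (SOME x. x \<noteq> 0 \<and> A x = Q.wt d n *s x) else 0)" for n
  have v: "v n \<noteq> 0 \<and> A (v n) = Q.wt d n *s v n" if "0 \<le> n" "n \<le> int d" for n
  proof -
    have "\<exists>x. x \<noteq> 0 \<and> A x = Q.wt d n *s x"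
      using ev_wt[of "Q.wt d n"] that by (auto simp: eigenvalues_def)
    from someI_ex[OF this] show ?thesis unfolding v_def using that by simp
  qed
  have v_outside: "v n = 0" if "\<not> (0 \<le> n \<and> n \<le> int d)" for n
    using that by (auto simp: v_def)
  have space: "\<exists>c. w = c *s v n" if "A w = Q.wt d n *s w" for w n
  proof (cases "0 \<le> n \<and> n \<le> int d")
    case True
    then show ?thesis
      using simple_eigenspace[OF dim1[of "nat n"], of "v n" w] v[of n] that
      by (simp add: Q.wt_def nat_le_iff)
  next
    case False
    then have "Q.wt d n \<notin> eigenvalues A"
      unfolding ev_wt by (auto simp: Q.wt_inj)
    then have "w = 0" using that by (auto simp: eigenvalues_def)
    then show ?thesis by (intro exI[of _ 0]) simp
  qed
  have "span (range v) = UNIV"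
  proof -
    obtain B where B: "independent B" "span B = UNIV" "\<forall>b\<in>B. \<exists>\<mu>. A b = \<mu> *s b"
      using diag by (auto simp: diagonalizable_def)
    have "b \<in> span (range v)" if b: "b \<in> B" for b
    proof -
      have "b \<noteq> 0" using b B(1) dependent_zero by blast
      moreover obtain \<mu> where "A b = \<mu> *s b" using b B(3) by blast
      ultimately have "\<mu> \<in> eigenvalues A" by (auto simp: eigenvalues_def)
      then obtain n where "A b = Q.wt d n *s b"
        using ev_wt[of \<mu>] \<open>A b = \<mu> *s b\<close> by auto
      then show ?thesis using space[of b n] by (auto intro: span_scale span_base)
    qed
    then have "span B \<subseteq> span (range v)" by (intro span_minimal) auto
    then show ?thesis using B(2) by auto
  qed
  moreover have "A (v n) = Q.wt d n *s v n" for n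
    using v[of n] v_outside[of n] Q.linear_0[OF lin] by (cases "0 \<le> n \<and> n \<le> int d") auto
  moreover have "v n \<noteq> 0 \<longleftrightarrow> 0 \<le> n \<and> n \<le> int d" for n
    using v[of n] v_outside[of n] by blast
  ultimately have "weight_basis scale q d A v"
    by (intro weight_basis.intro weight_basis_axioms.intro Q lin space)
  then show ?thesis unfolding A_def by blast
qed

text \<open>
  The off-diagonal entries that define the evaluation parameter exist only for \<open>d \<ge> 1\<close>; this is
  where nontriviality of an evaluation module enters.
\<close>

lemma diameter_0_trivial:
  assumes Q: "q_space scale q"
    and type: "diameter_and_type 0 1" and shape: "has_shape 0 (replicate (Suc 0) 1)"
  shows "trivial_module"
proof -
  interpret Q: q_space scale q by fact
  have id: "act (boxq_x q i j) w = w" if ij: "j - i = 1 \<or> j - i = 2" for i j w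
  proof -
    obtain v where "weight_basis scale q 0 (act (boxq_x q i j)) v"
      using weight_basis_exists[OF Q type shape ij] by blast
    then interpret W: weight_basis scale q 0 "act (boxq_x q i j)" v .
    have "act (boxq_x q i j) = (\<lambda>w. w)"
      by (rule W.endo_eqI[OF W.linear_A linear_ident]) (simp add: W.A_v Q.wt_def)
    then show ?thesis by metis
  qed
  have "dim (eigenspace (act (boxq_x q 0 1)) 1) = 1"
    using shape by (simp add: has_shape_def)
  moreover have "eigenspace (act (boxq_x q 0 1)) 1 = UNIV"
    using id[of 1 0] by (simp add: eigenspace_def)
  ultimately show ?thesis using id by (simp add: trivial_module_def)
qed

lemma evaluation_box_operators:
  assumes Q: "q_space scale q" and "evaluation_module"
  obtains d where "box_operators scale q d (\<lambda>i j. act (boxq_x q i j))"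
proof -
  interpret Q: q_space scale q by fact
  obtain d where d: "diameter_and_type d 1" "has_shape d (replicate (Suc d) 1)"
    and nt: "\<not> trivial_module"
    using assms(2) by (auto simp: evaluation_module_def)
  have "1 \<le> d"
    using diameter_0_trivial[OF Q] d nt by (cases d) auto
  have x: "act (boxq_x q i j) = free_act (free_std i j)" for i j
    by (simp add: free_act_def boxq_x_def)
  have "box_operators scale q d (\<lambda>i j. act (boxq_x q i j))"
  proof (intro box_operators.intro box_operators_axioms.intro Q)
    show "1 \<le> d" by fact
    show "Vector_Spaces.linear scale scale (act (boxq_x q i j))" for i j
      unfolding x by (rule linear_free_act)
    show "act (boxq_x q i j) (act (boxq_x q j i) w) = w" if "j - i = 2" for i j w
      unfolding x by (rule free_act_inverse[OF that])
    show "Q.q_weyl (act (boxq_x q i j)) (act (boxq_x q j k))"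
      if "(j - i, k - j) \<in> {(1, 1), (1, 2), (2, 1)}" for i j k
      unfolding x Q.q_weyl_def using free_act_weyl[OF that Q.q_minus_inverse_nonzero] by blast
    show "\<exists>v. weight_basis scale q d (act (boxq_x q i j)) v" if "j - i = 1 \<or> j - i = 2" for i j
      by (rule weight_basis_exists[OF Q d that])
  qed
  then show ?thesis by (rule that)
qed

lemma intertwines_algebra:
  assumes f: "Vector_Spaces.linear scale scale f"
    and gen: "\<And>g v. f (free_act (free_var g) v) = free_act (free_var (\<phi> g)) (f v)"
  shows "f (free_act p v) = free_act (relabel \<phi> p) (f v)"
proof -
  interpret f: Vector_Spaces.linear scale scale f by fact
  have "\<forall>v. f (free_act p v) = free_act (relabel \<phi> p) (f v)"
    by (induction p rule: free_algebra_induct)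
      (simp_all add: free_act_const free_act_add free_act_mult relabel_add relabel_mult gen f.add f.scale)
  then show ?thesis by blast
qed

text \<open>
  The twisted action is the action pulled back along the inverse of \<open>\<pi>\<close>, which is again an
  automorphism over the ground field.
\<close>

lemma twist_module:
  assumes "boxq_automorphism q \<pi>"
  shows "boxq_module q scale (twist q \<pi> act)"
proof -
  interpret R: ring "boxq q" by (rule ring_boxq)
  let ?inv = "inv_into (carrier (boxq q)) \<pi>"
  have iso: "\<pi> \<in> ring_iso (boxq q) (boxq q)"
    and sm: "\<And>c \<zeta>. \<zeta> \<in> carrier (boxq q) \<Longrightarrow> \<pi> (boxq_smult q c \<zeta>) = boxq_smult q c (\<pi> \<zeta>)"
    using assms by (auto simp: boxq_automorphism_def)
  have bij: "bij_betw \<pi> (carrier (boxq q)) (carrier (boxq q))"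
    using iso by (simp add: ring_iso_def)
  have "?inv \<in> ring_iso (boxq q) (boxq q)"
    using ring_iso_set_sym[OF R.ring_axioms iso] .
  then have hom: "?inv \<in> ring_hom (boxq q) (boxq q)" by (simp add: ring_iso_def)
  have cl: "?inv \<zeta> \<in> carrier (boxq q)" if "\<zeta> \<in> carrier (boxq q)" for \<zeta>
    using ring_hom_closed[OF hom that] .
  have smc: "boxq_smult q c \<zeta> \<in> carrier (boxq q)" if "\<zeta> \<in> carrier (boxq q)" for c \<zeta>
    using that by (auto simp: boxq_smult_def)
  have inv_sm: "?inv (boxq_smult q c \<zeta>) = boxq_smult q c (?inv \<zeta>)"
    if "\<zeta> \<in> carrier (boxq q)" for c \<zeta>
  proof -
    have "boxq_smult q c \<zeta> = \<pi> (boxq_smult q c (?inv \<zeta>))"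
      using sm[OF cl[OF that]] bij_betw_inv_into_right[OF bij that] by simp
    then show ?thesis using bij_betw_inv_into_left[OF bij smc[OF cl[OF that]]] by simp
  qed
  show ?thesis
    using cl
    by (intro boxq_module.intro boxq_module_axioms.intro vector_space_axioms)
      (simp_all add: twist_def act_linear act_add act_mult act_one act_smult inv_sm
        ring_hom_add[OF hom] ring_hom_mult[OF hom] ring_hom_one[OF hom])
qed

end

lemma boxq_automorphism_rho_squared: "boxq_automorphism q (rho \<circ> rho)"
proof -
  have iso: "rho \<in> ring_iso (boxq q) (boxq q)"
    and sm: "\<And>c \<zeta>. \<zeta> \<in> carrier (boxq q) \<Longrightarrow> rho (boxq_smult q c \<zeta>) = boxq_smult q c (rho \<zeta>)"
    using boxq_automorphism_rho[of q] by (auto simp: boxq_automorphism_def)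
  have "rho \<circ> rho \<in> ring_iso (boxq q) (boxq q)"
    using ring_iso_set_trans[OF iso iso] .
  then show ?thesis
    using ring_hom_closed[of rho "boxq q" "boxq q"] iso sm
    by (simp add: boxq_automorphism_def ring_iso_def)
qed

text \<open>
  Since \<open>\<rho>\<^sup>4 = 1\<close>, the map \<open>\<rho>\<^sup>2\<close> is its own inverse.
\<close>

lemma inv_rho_squared_class:
  "inv_into (carrier (boxq q)) (rho \<circ> rho) (boxq_class q p)
     = boxq_class q (relabel (shift_gen \<circ> shift_gen) p)"
proof (rule inv_into_f_eq)
  show "inj_on (rho \<circ> rho) (carrier (boxq q))"
    using boxq_automorphism_rho_squared[of q]
    by (auto simp: boxq_automorphism_def ring_iso_def bij_betw_def)
qed (simp_all add: carrier_boxq rho_class relabel_relabel[symmetric] relabel_shift_4)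

theorem corollary9p18:
  fixes q :: "'f::alg_closed_field"
    and scale :: "'f \<Rightarrow> 'v::ab_group_add \<Rightarrow> 'v"
    and act :: "'f boxq_elem \<Rightarrow> 'v \<Rightarrow> 'v"
  assumes "q \<noteq> 0"
    and "\<And>n::nat. n > 0 \<Longrightarrow> q ^ n \<noteq> 1"
    and "boxq_module q scale act"
    and "boxq_module.evaluation_module q scale act"
  shows "boxq_isomorphic q scale act scale (twist q (rho \<circ> rho) act)"
proof -
  interpret V: boxq_module q scale act by fact
  have Q: "q_space scale q"
    by (intro q_space.intro q_space_axioms.intro V.vector_space_axioms assms(1,2))
  obtain d where "box_operators scale q d (\<lambda>i j. act (boxq_x q i j))"
    using V.evaluation_box_operators[OF Q assms(4)] .
  then obtain f where f: "Vector_Spaces.linear scale scale f" "bij f"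
    and fx: "\<And>i j w. j - i = 1 \<or> j - i = 2 \<Longrightarrow>
      f (act (boxq_x q i j) w) = act (boxq_x q (i + 2) (j + 2)) (f w)"
    using box_operators.half_turn_intertwiner by blast
  have gen: "f (V.free_act (free_var g) v) = V.free_act (free_var ((shift_gen \<circ> shift_gen) g)) (f v)" for g v
  proof (cases g rule: std_gen_cases)
    case (1 i j)
    have "(j + 1) - (i + 1) = 1 \<or> (j + 1) - (i + 1) = 2" using 1(2) by simp
    from shift_gen_std[OF this] have "shift_gen (shift_gen g) = std (i + 2) (j + 2)"
      using shift_gen_std[OF 1(2)] 1(1) by (simp add: add.assoc)
    then show ?thesis using fx[OF 1(2)] by (simp add: V.free_act_def boxq_x_def 1(1))
  qed
  have "f (act \<zeta> v) = twist q (rho \<circ> rho) act \<zeta> (f v)" if \<zeta>: "\<zeta> \<in> carrier (boxq q)" for \<zeta> v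
  proof -
    obtain p where "\<zeta> = boxq_class q p" using \<zeta> unfolding carrier_boxq by blast
    then show ?thesis
      using V.intertwines_algebra[OF f(1) gen, of p v]
      by (simp add: twist_def inv_rho_squared_class V.free_act_def del: o_apply)
  qed
  then show ?thesis
    unfolding boxq_isomorphic_def
    using assms(3) V.twist_module[OF boxq_automorphism_rho_squared] f by blast
qed

end
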